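(* Let $F$ be a field of characteristic zero and let $W$ and $V$ be KV-modules of a KV-algebra $\mathcal{A}$ over $F$. Then there is a bijective correspondence between $E_1^{1,1}(\mathcal{A}\times W,V)$ and the set $\mathrm{Ext}(W,V)$ of equivalence classes of splittable exact sequences of KV-modules $0\to V\to T\to W\to 0$.
   Context: A KV-algebra over $F$ is an $F$-vector space $\mathcal{A}$ with a bilinear multiplication such that the associator $(a,b,c)=(ab)c-a(bc)$ satisfies $(a,b,c)=(b,a,c)$ for all $a,b,c$. An $\mathcal{A}$-KV-module is an $F$-vector space $W$ with bilinear maps $(a,w)\mapsto aw$, $(w,a)\mapsto wa$ into $W$ such that $(a,b,w)=(b,a,w)$ and $(a,w,b)=(w,a,b)$ for all $a,b\in\mathcal{A}$, $w\in W$, where $(a,b,w)=(ab)w-a(bw)$, $(a,w,b)=(aw)b-a(wb)$, $(w,a,b)=(wa)b-w(ab)$. Morphisms of KV-modules are linear maps commuting with both actions. For a KV-algebra $\mathcal{B}$, a $\mathcal{B}$-KV-module $V$ and $q\ge1$, $C_q(\mathcal{B},V)$ is the space of $q$-linear maps from $\mathcal{B}$ to $V$, and $\delta:C_q(\mathcal{B},V)\to C_{q+1}(\mathcal{B},V)$ is $$(\delta f)(b_1,\dots,b_{q+1})=\sum_{j=1}^{q}(-1)^j\Big\{(b_jf)(b_1,\dots,\widehat{b_j},\dots,b_{q+1})+\big(f(b_1,\dots,\widehat{b_j},\dots,b_q,b_j)\big)b_{q+1}\Big\},$$ with $(bf)(c_1,\dots,c_q)=b(f(c_1,\dots,c_q))-\sum_i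 f(c_1,\dots,bc_i,\dots,c_q)$; one has $\delta\circ\delta=0$. Given KV-modules $W,V$ of $\mathcal{A}$, $\mathcal{A}\times W\cong\mathcal{A}\oplus W$ is the KV-algebra with multiplication $(a,w)(a',w')=(aa',aw'+wa')$, and $V$ is a KV-module over it via $(a,w)v=av$, $v(a,w)=va$. $C_{p,q}(\mathcal{A}\times W,V)\subset C_{p+q}(\mathcal{A}\times W,V)$ is the subspace of $(p+q)$-linear maps homogeneous of degree $p$ in the arguments from $W$ and of degree $q$ in the arguments from $\mathcal{A}$ (i.e. vanishing on a tuple of elements each lying in $\mathcal{A}$ or in $W$, unless exactly $p$ of them are from $W$ and $q$ from $\mathcal{A}$). $\delta$ maps $C_{1,q}$ to $C_{1,q+1}$; for $q=0$, $C_{1,0}(\mathcal{A}\times W,V)=L(W,V)$ (linear maps $W\to V$), and $\delta\theta(a,w)=-a\theta(w)+\theta(aw)$, $\delta\theta(w,a)=\theta(wa)-(\theta(w))a$. Then $E_1^{1,1}(\mathcal{A}\times W,V)=\ker(\delta: C_{1,1}\to C_{1,2})/\delta C_{1,0}$. An exact sequence $0\to V\to T\to W\to 0$ of $\mathcal{A}$-KV-modules is splittable if $V$ is a direct summand of $T$ as a vector space. Two such sequences are equivalent if there is an isomorphism of KV-modules between the middle terms inducing the identity on $V$ and on $W$. *)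

theory Defs
  imports "HOL-Algebra.Module" "HOL-Algebra.AbelCoset"
begin

section \<open>Vector spaces and KV-algebras\<close>

text \<open>
  A vector space over a field \<open>F\<close> is a \<^locale>\<open>module\<close> over \<open>F\<close>. The record type of
  modules extends the one of rings; unless a multiplication is mentioned explicitly, the
  components \<^const>\<open>mult\<close> and \<^const>\<open>one\<close> play no role.
\<close>

definition char_zero :: "('f, 'z) ring_scheme \<Rightarrow> bool" where
  "char_zero F \<longleftrightarrow> (\<forall>n::nat. n > 0 \<longrightarrow> [n] \<cdot>\<^bsub>F\<^esub> \<one>\<^bsub>F\<^esub> \<noteq> \<zero>\<^bsub>F\<^esub>)"

definition linear_maps ::
    "('f, 'z) ring_scheme \<Rightarrow> ('f, 'm, 'x) module_scheme \<Rightarrow> ('f, 'n, 'y) module_scheme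
      \<Rightarrow> ('m \<Rightarrow> 'n) set" where
  "linear_maps F M N = {h \<in> hom (add_monoid M) (add_monoid N).
     \<forall>c\<in>carrier F. \<forall>x\<in>carrier M. h (c \<odot>\<^bsub>M\<^esub> x) = c \<odot>\<^bsub>N\<^esub> h x}"

definition bilinear_maps ::
    "('f, 'z) ring_scheme \<Rightarrow> ('f, 'l, 'u) module_scheme \<Rightarrow> ('f, 'm, 'x) module_scheme
      \<Rightarrow> ('f, 'n, 'y) module_scheme \<Rightarrow> ('l \<Rightarrow> 'm \<Rightarrow> 'n) set" where
  "bilinear_maps F L M N = {b.
     (\<forall>x\<in>carrier L. (\<lambda>y. b x y) \<in> linear_maps F M N) \<and>
     (\<forall>y\<in>carrier M. (\<lambda>x. b x y) \<in> linear_maps F L N)}"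

text \<open>The underlying vector space of \<open>A\<close> together with the component \<^const>\<open>mult\<close> is the
  algebra; no unit is required.\<close>

locale kv_algebra = field F + module F A
  for F :: "('f, 'z) ring_scheme" (structure) and A :: "('f, 'a, 'x) module_scheme" (structure) +
  assumes mult_bilinear: "mult A \<in> bilinear_maps F A A A"
    and associator_symmetric:
      "\<lbrakk>a \<in> carrier A; b \<in> carrier A; c \<in> carrier A\<rbrakk> \<Longrightarrow>
        (a \<otimes>\<^bsub>A\<^esub> b) \<otimes>\<^bsub>A\<^esub> c \<ominus>\<^bsub>A\<^esub> a \<otimes>\<^bsub>A\<^esub> (b \<otimes>\<^bsub>A\<^esub> c) =
        (b \<otimes>\<^bsub>A\<^esub> a) \<otimes>\<^bsub>A\<^esub> c \<ominus>\<^bsub>A\<^esub> b \<otimes>\<^bsub>A\<^esub> (a \<otimes>\<^bsub>A\<^esub> c)"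

record ('f, 'a, 'w) kv_mod = "('f, 'w) module" +
  lact :: "'a \<Rightarrow> 'w \<Rightarrow> 'w"
  ract :: "'w \<Rightarrow> 'a \<Rightarrow> 'w"

locale kv_module = kv_algebra F A + W?: module F W
  for F :: "('f, 'z) ring_scheme" (structure) and A :: "('f, 'a, 'x) module_scheme" (structure)
    and W :: "('f, 'a, 'w, 'y) kv_mod_scheme" (structure) +
  assumes lact_bilinear: "lact W \<in> bilinear_maps F A W W"
    and ract_bilinear: "ract W \<in> bilinear_maps F W A W"
    and associator_abw:
      "\<lbrakk>a \<in> carrier A; b \<in> carrier A; w \<in> carrier W\<rbrakk> \<Longrightarrow>
        lact W (a \<otimes>\<^bsub>A\<^esub> b) w \<ominus>\<^bsub>W\<^esub> lact W a (lact W b w) =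
        lact W (b \<otimes>\<^bsub>A\<^esub> a) w \<ominus>\<^bsub>W\<^esub> lact W b (lact W a w)"
    and associator_awb:
      "\<lbrakk>a \<in> carrier A; b \<in> carrier A; w \<in> carrier W\<rbrakk> \<Longrightarrow>
        ract W (lact W a w) b \<ominus>\<^bsub>W\<^esub> lact W a (ract W w b) =
        ract W (ract W w a) b \<ominus>\<^bsub>W\<^esub> ract W w (a \<otimes>\<^bsub>A\<^esub> b)"

definition kv_hom ::
    "('f, 'z) ring_scheme \<Rightarrow> ('f, 'a, 'x) module_scheme \<Rightarrow> ('f, 'a, 'm, 'u) kv_mod_scheme
      \<Rightarrow> ('f, 'a, 'n, 'v) kv_mod_scheme \<Rightarrow> ('m \<Rightarrow> 'n) set" where
  "kv_hom F A M N = {h \<in> linear_maps F M N.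
     \<forall>a\<in>carrier A. \<forall>x\<in>carrier M.
       h (lact M a x) = lact N a (h x) \<and> h (ract M x a) = ract N (h x) a}"


section \<open>The cochain complex of a KV-algebra\<close>

definition tuples :: "('b, 'x) partial_object_scheme \<Rightarrow> nat \<Rightarrow> 'b list set" where
  "tuples B q = {bs. length bs = q \<and> set bs \<subseteq> carrier B}"

text \<open>A \<open>q\<close>-linear map is a function of argument lists of length \<open>q\<close>; it is normalised to be
  \<^const>\<open>undefined\<close> elsewhere, so that equal maps are equal as functions.\<close>

definition multilinear_maps ::
    "('f, 'z) ring_scheme \<Rightarrow> ('f, 'b, 'x) module_scheme \<Rightarrow> ('f, 'v, 'y) module_scheme
      \<Rightarrow> nat \<Rightarrow> ('b list \<Rightarrow> 'v) set" where
  "multilinear_maps F B V q = {f \<in> tuples B q \<rightarrow>\<^sub>E carrier V.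
     \<forall>bs\<in>tuples B q. \<forall>i<q. (\<lambda>x. f (bs[i := x])) \<in> linear_maps F B V}"

definition cochains ::
    "('f, 'z) ring_scheme \<Rightarrow> ('f, 'b, 'x) module_scheme \<Rightarrow> ('f, 'v, 'y) module_scheme
      \<Rightarrow> nat \<Rightarrow> ('f, 'b list \<Rightarrow> 'v) module" where
  "cochains F B V q = \<lparr>carrier = multilinear_maps F B V q,
     mult = undefined, one = undefined,
     zero = (\<lambda>bs\<in>tuples B q. \<zero>\<^bsub>V\<^esub>),
     add = (\<lambda>f g. \<lambda>bs\<in>tuples B q. f bs \<oplus>\<^bsub>V\<^esub> g bs),
     smult = (\<lambda>c f. \<lambda>bs\<in>tuples B q. c \<odot>\<^bsub>V\<^esub> f bs)\<rparr>"

definition cochain_act ::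
    "('f, 'b, 'x) module_scheme \<Rightarrow> ('f, 'b, 'v, 'y) kv_mod_scheme \<Rightarrow> nat
      \<Rightarrow> 'b \<Rightarrow> ('b list \<Rightarrow> 'v) \<Rightarrow> 'b list \<Rightarrow> 'v" where
  "cochain_act B V q b f cs =
     lact V b (f cs) \<ominus>\<^bsub>V\<^esub> (\<Oplus>\<^bsub>V\<^esub>i\<in>{..<q}. f (cs[i := b \<otimes>\<^bsub>B\<^esub> (cs ! i)]))"

definition omit_nth :: "nat \<Rightarrow> 'b list \<Rightarrow> 'b list" where
  "omit_nth j bs = take j bs @ drop (Suc j) bs"

text \<open>Indices start at \<open>0\<close>, so \<open>bs ! j\<close> is \<open>b\<^sub>j\<^sub>+\<^sub>1\<close> and comes with the sign \<open>(-1)\<close> to the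
  power \<open>j + 1\<close>; \<open>last bs\<close> is \<open>b\<^sub>q\<^sub>+\<^sub>1\<close>.\<close>

definition coboundary ::
    "('f, 'z) ring_scheme \<Rightarrow> ('f, 'b, 'x) module_scheme \<Rightarrow> ('f, 'b, 'v, 'y) kv_mod_scheme
      \<Rightarrow> nat \<Rightarrow> ('b list \<Rightarrow> 'v) \<Rightarrow> ('b list \<Rightarrow> 'v)" where
  "coboundary F B V q f = (\<lambda>bs\<in>tuples B (Suc q).
     \<Oplus>\<^bsub>V\<^esub>j\<in>{..<q}. ((\<ominus>\<^bsub>F\<^esub> \<one>\<^bsub>F\<^esub>) [^]\<^bsub>F\<^esub> Suc j) \<odot>\<^bsub>V\<^esub>
       (cochain_act B V q (bs ! j) f (omit_nth j bs)
        \<oplus>\<^bsub>V\<^esub> ract V (f (butlast (omit_nth j bs) @ [bs ! j])) (last bs)))"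


section \<open>Bigraded cochains on the semidirect product\<close>

definition semidirect ::
    "('f, 'a, 'x) module_scheme \<Rightarrow> ('f, 'a, 'w, 'y) kv_mod_scheme \<Rightarrow> ('f, 'a \<times> 'w) module" where
  "semidirect A W = \<lparr>carrier = carrier A \<times> carrier W,
     mult = (\<lambda>(a, w) (a', w'). (a \<otimes>\<^bsub>A\<^esub> a', lact W a w' \<oplus>\<^bsub>W\<^esub> ract W w a')),
     one = undefined,
     zero = (\<zero>\<^bsub>A\<^esub>, \<zero>\<^bsub>W\<^esub>),
     add = (\<lambda>(a, w) (a', w'). (a \<oplus>\<^bsub>A\<^esub> a', w \<oplus>\<^bsub>W\<^esub> w')),
     smult = (\<lambda>c (a, w). (c \<odot>\<^bsub>A\<^esub> a, c \<odot>\<^bsub>W\<^esub> w))\<rparr>"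

definition inflate ::
    "('f, 'a, 'v, 'y) kv_mod_scheme \<Rightarrow> ('f, 'a \<times> 'w, 'v) kv_mod" where
  "inflate V = \<lparr>carrier = carrier V, mult = mult V, one = one V, zero = zero V, add = add V,
     smult = smult V, lact = (\<lambda>(a, w) v. lact V a v), ract = (\<lambda>v (a, w). ract V v a)\<rparr>"

text \<open>\<open>S\<close> is the set of positions at which the argument is taken from \<open>W\<close>; at the other
  positions it is taken from \<open>A\<close>.\<close>

definition bicochains ::
    "('f, 'z) ring_scheme \<Rightarrow> ('f, 'a, 'x) module_scheme \<Rightarrow> ('f, 'a, 'w, 'y) kv_mod_scheme
      \<Rightarrow> ('f, 'a, 'v, 'u) kv_mod_scheme \<Rightarrow> nat \<Rightarrow> nat
      \<Rightarrow> ('f, ('a \<times> 'w) list \<Rightarrow> 'v) module" where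
  "bicochains F A W V p q = (let C = cochains F (semidirect A W) V (p + q) in
     C\<lparr>carrier := {f \<in> carrier C.
       \<forall>bs\<in>tuples (semidirect A W) (p + q). \<forall>S\<subseteq>{..<p + q}.
         (\<forall>i<p + q. if i \<in> S then fst (bs ! i) = \<zero>\<^bsub>A\<^esub> else snd (bs ! i) = \<zero>\<^bsub>W\<^esub>) \<longrightarrow>
         card S \<noteq> p \<longrightarrow> f bs = \<zero>\<^bsub>V\<^esub>}\<rparr>)"

abbreviation bicoboundary ::
    "('f, 'z) ring_scheme \<Rightarrow> ('f, 'a, 'x) module_scheme \<Rightarrow> ('f, 'a, 'w, 'y) kv_mod_scheme
      \<Rightarrow> ('f, 'a, 'v, 'u) kv_mod_scheme \<Rightarrow> nat
      \<Rightarrow> (('a \<times> 'w) list \<Rightarrow> 'v) \<Rightarrow> (('a \<times> 'w) list \<Rightarrow> 'v)" where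
  "bicoboundary F A W V \<equiv> coboundary F (semidirect A W) (inflate V)"

text \<open>For \<open>q = 0\<close>, an element of \<open>bicochains F A W V 1 0\<close> is a linear map on \<open>W\<close> extended by
  zero to \<open>A\<close>, so \<open>bicoboundary\<close> is also the differential on this space.\<close>

definition E1_11 ::
    "('f, 'z) ring_scheme \<Rightarrow> ('f, 'a, 'x) module_scheme \<Rightarrow> ('f, 'a, 'w, 'y) kv_mod_scheme
      \<Rightarrow> ('f, 'a, 'v, 'u) kv_mod_scheme \<Rightarrow> (('a \<times> 'w) list \<Rightarrow> 'v) set set" where
  "E1_11 F A W V =
    (let Z = a_kernel (bicochains F A W V 1 1) (bicochains F A W V 1 2) (bicoboundary F A W V 2);
         B = bicoboundary F A W V 1 ` carrier (bicochains F A W V 1 0)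
     in a_rcosets\<^bsub>(bicochains F A W V 1 1)\<lparr>carrier := Z\<rparr>\<^esub> B)"


section \<open>Splittable exact sequences\<close>

text \<open>A triple \<open>(T, i, p)\<close> stands for \<open>0 \<rightarrow> V \<rightarrow> T \<rightarrow> W \<rightarrow> 0\<close> with the maps
  \<open>i : V \<rightarrow> T\<close> and \<open>p : T \<rightarrow> W\<close>.\<close>

type_synonym ('f, 'a, 'v, 't, 'w) sequence = "('f, 'a, 't) kv_mod \<times> ('v \<Rightarrow> 't) \<times> ('t \<Rightarrow> 'w)"

definition exact_sequences ::
    "('f, 'z) ring_scheme \<Rightarrow> ('f, 'a, 'x) module_scheme \<Rightarrow> ('f, 'a, 'w, 'y) kv_mod_scheme
      \<Rightarrow> ('f, 'a, 'v, 'u) kv_mod_scheme \<Rightarrow> ('f, 'a, 'v, 't, 'w) sequence set" where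
  "exact_sequences F A W V = {(T, i, p). kv_module F A T \<and>
     i \<in> kv_hom F A V T \<and> p \<in> kv_hom F A T W \<and>
     inj_on i (carrier V) \<and> i ` carrier V = a_kernel T W p \<and> p ` carrier T = carrier W}"

definition splittable ::
    "('f, 'z) ring_scheme \<Rightarrow> ('f, 'a, 'v, 'u) kv_mod_scheme
      \<Rightarrow> ('f, 'a, 'v, 't, 'w) sequence \<Rightarrow> bool" where
  "splittable F V = (\<lambda>(T, i, p). \<exists>U. submodule U F T \<and>
     i ` carrier V \<inter> U = {\<zero>\<^bsub>T\<^esub>} \<and> i ` carrier V <+>\<^bsub>T\<^esub> U = carrier T)"

definition equivalent_sequences ::
    "('f, 'z) ring_scheme \<Rightarrow> ('f, 'a, 'x) module_scheme \<Rightarrow> ('f, 'a, 'v, 'u) kv_mod_scheme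
      \<Rightarrow> ('f, 'a, 'v, 't, 'w) sequence \<Rightarrow> ('f, 'a, 'v, 't, 'w) sequence \<Rightarrow> bool" where
  "equivalent_sequences F A V = (\<lambda>(T, i, p) (T', i', p').
     \<exists>g \<in> kv_hom F A T T'. bij_betw g (carrier T) (carrier T') \<and>
       (\<forall>v\<in>carrier V. g (i v) = i' v) \<and> (\<forall>t\<in>carrier T. p' (g t) = p t))"

text \<open>The carriers of the middle terms are arbitrary subsets of the type \<open>'t\<close>, which plays
  the role of a universe. If the set \<open>carrier V \<times> carrier W\<close> embeds into \<open>'t\<close>, then every
  splittable exact sequence (over whatever type) is equivalent to one in \<open>'t\<close>, because its
  middle term is in bijection with \<open>carrier V \<times> carrier W\<close>.\<close>

definition Ext ::
    "('f, 'z) ring_scheme \<Rightarrow> ('f, 'a, 'x) module_scheme \<Rightarrow> ('f, 'a, 'w, 'y) kv_mod_scheme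
      \<Rightarrow> ('f, 'a, 'v, 'u) kv_mod_scheme \<Rightarrow> ('f, 'a, 'v, 't, 'w) sequence set set" where
  "Ext F A W V =
    (let S = {s \<in> exact_sequences F A W V. splittable F V s}
     in S // {(s, s') \<in> S \<times> S. equivalent_sequences F A V s s'})"

end

theory Submission
  imports Defs
begin

text \<open>A splitting of vector spaces identifies the middle term \<open>T\<close> with \<open>V \<oplus> W\<close> in such a way that \<open>V\<close>
is embedded as the first summand and the projection to \<open>W\<close> is the second coordinate. Since both
maps are morphisms, the two actions on \<open>V \<oplus> W\<close> must have the form
\<open>a (v, w) = (a v + \<phi>(a, w), a w)\<close> and \<open>(v, w) a = (v a + \<psi>(w, a), w a)\<close>
for bilinear maps \<open>\<phi> : A \<times> W \<rightarrow> V\<close> and \<open>\<psi> : W \<times> A \<rightarrow> V\<close>.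

A pair \<open>(\<phi>, \<psi>)\<close> of this kind is the same thing as a bilinear cochain of bidegree \<open>(1,1)\<close>, namely
\<open>f((a, w), (a', w')) = \<phi>(a, w') + \<psi>(w, a')\<close>. The two KV-module identities for the actions above
say exactly that \<open>\<delta> f = 0\<close>: the identity for \<open>(a, b, w)\<close> is the value of \<open>\<delta> f\<close> on arguments from
\<open>A, A, W\<close>, the identity for \<open>(a, w, b)\<close> the value on arguments from \<open>A, W, A\<close>, and the remaining
values follow from these by trilinearity, homogeneity, and antisymmetry of \<open>\<delta> f\<close> in its first two
arguments (\<open>twisted_sum_kv_module_iff\<close>, \<open>coboundary_cocycle_iff\<close>).

An equivalence between two such extensions fixes \<open>V\<close> and induces the identity on \<open>W\<close>, so that it is
\<open>(v, w) \<mapsto> (v + \<theta>(w), w)\<close> for a linear map \<open>\<theta> : W \<rightarrow> V\<close>. Compatibility with the actions means that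
the two cocycles differ by \<open>\<theta>(a w) - a \<theta>(w)\<close> and \<open>\<theta>(w a) - \<theta>(w) a\<close>, which are the components of
\<open>\<delta> \<theta>\<close> (\<open>sequence_iso_shift\<close>, \<open>sequence_iso_imp_cohomologous\<close>, \<open>coboundary_linear_cochain\<close>).

The vectors \<open>\<delta> \<theta>\<close> with \<open>\<theta> \<in> C\<^bsub>1,0\<^esub>\<close> therefore lead from a cocycle exactly to the cocycles with an
equivalent extension. The shift by \<open>\<theta>\<close> transports the module structure, so that the sum of a cocycle
and a coboundary is again a cocycle; and since equivalence of sequences is an equivalence relation,
the cosets of \<open>\<delta> C\<^bsub>1,0\<^esub>\<close> in the kernel are the fibres of the map from cocycles to classes of
sequences. The extension on pairs is carried into the type of the given middle terms by the embedding of
\<open>V \<times> W\<close>, and each class of splittable sequences is attained, as explained at the beginning.\<close>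

section \<open>Differences, linear and bilinear maps\<close>

lemma (in abelian_group) minus_eq_minus_iff:
  assumes "x \<in> carrier G" "y \<in> carrier G" "z \<in> carrier G" "u \<in> carrier G"
  shows "x \<ominus> y = z \<ominus> u \<longleftrightarrow> x \<oplus> u = z \<oplus> y"
proof -
  have "x \<ominus> y = z \<ominus> u \<longleftrightarrow> (x \<ominus> y) \<oplus> (y \<oplus> u) = (z \<ominus> u) \<oplus> (y \<oplus> u)"
    using assms by simp
  also have "(x \<ominus> y) \<oplus> (y \<oplus> u) = x \<oplus> u"
    using assms by (simp add: minus_eq a_assoc r_neg1)
  also have "(z \<ominus> u) \<oplus> (y \<oplus> u) = z \<oplus> y"
    using assms by (simp add: minus_eq a_assoc r_neg1 a_comm[of y u])
  finally show ?thesis .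
qed

lemma (in abelian_group) eq_minus_iff:
  assumes "x \<in> carrier G" "y \<in> carrier G" "z \<in> carrier G"
  shows "x = y \<ominus> z \<longleftrightarrow> x \<oplus> z = y"
proof -
  have "x \<ominus> \<zero> = x"
    using assms by (simp add: minus_eq minus_equality[of \<zero> \<zero>])
  then show ?thesis using minus_eq_minus_iff[of x \<zero> y z] assms by simp
qed

lemma linear_maps_iff:
  "h \<in> linear_maps F M N \<longleftrightarrow>
    (\<forall>x\<in>carrier M. h x \<in> carrier N) \<and>
    (\<forall>x\<in>carrier M. \<forall>y\<in>carrier M. h (x \<oplus>\<^bsub>M\<^esub> y) = h x \<oplus>\<^bsub>N\<^esub> h y) \<and>
    (\<forall>c\<in>carrier F. \<forall>x\<in>carrier M. h (c \<odot>\<^bsub>M\<^esub> x) = c \<odot>\<^bsub>N\<^esub> h x)"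
  by (auto simp: linear_maps_def hom_def)

lemma linear_maps_zero:
  assumes "module F M" "module F N" "h \<in> linear_maps F M N"
  shows "h \<zero>\<^bsub>M\<^esub> = \<zero>\<^bsub>N\<^esub>"
proof -
  interpret M: module F M by fact
  interpret N: module F N by fact
  have "h \<zero>\<^bsub>M\<^esub> = h (\<zero>\<^bsub>F\<^esub> \<odot>\<^bsub>M\<^esub> \<zero>\<^bsub>M\<^esub>)" by simp
  also have "\<dots> = \<zero>\<^bsub>F\<^esub> \<odot>\<^bsub>N\<^esub> h \<zero>\<^bsub>M\<^esub>"
    using assms(3) unfolding linear_maps_iff by blast
  also have "\<dots> = \<zero>\<^bsub>N\<^esub>" using assms(3) by (simp add: linear_maps_iff)
  finally show ?thesis .
qed

lemma linear_maps_minus: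
  assumes "module F M" "module F N" "h \<in> linear_maps F M N" "x \<in> carrier M"
  shows "h (\<ominus>\<^bsub>M\<^esub> x) = \<ominus>\<^bsub>N\<^esub> h x"
proof -
  interpret M: module F M by fact
  interpret N: module F N by fact
  have *: "\<And>c x. \<lbrakk>c \<in> carrier F; x \<in> carrier M\<rbrakk> \<Longrightarrow> h (c \<odot>\<^bsub>M\<^esub> x) = c \<odot>\<^bsub>N\<^esub> h x" "h x \<in> carrier N"
    using assms(3,4) by (simp_all add: linear_maps_iff)
  have "h (\<ominus>\<^bsub>M\<^esub> x) = h ((\<ominus>\<^bsub>F\<^esub> \<one>\<^bsub>F\<^esub>) \<odot>\<^bsub>M\<^esub> x)" using assms(4) by (simp add: M.smult_l_minus)
  also have "\<dots> = \<ominus>\<^bsub>N\<^esub> h x" using assms(4) * by (simp add: N.smult_l_minus)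
  finally show ?thesis .
qed

lemma bilinear_maps_iff:
  "b \<in> bilinear_maps F L M N \<longleftrightarrow>
    (\<forall>x\<in>carrier L. \<forall>y\<in>carrier M. b x y \<in> carrier N) \<and>
    (\<forall>x\<in>carrier L. \<forall>y\<in>carrier M. \<forall>y'\<in>carrier M. b x (y \<oplus>\<^bsub>M\<^esub> y') = b x y \<oplus>\<^bsub>N\<^esub> b x y') \<and>
    (\<forall>x\<in>carrier L. \<forall>x'\<in>carrier L. \<forall>y\<in>carrier M. b (x \<oplus>\<^bsub>L\<^esub> x') y = b x y \<oplus>\<^bsub>N\<^esub> b x' y) \<and>
    (\<forall>c\<in>carrier F. \<forall>x\<in>carrier L. \<forall>y\<in>carrier M. b x (c \<odot>\<^bsub>M\<^esub> y) = c \<odot>\<^bsub>N\<^esub> b x y) \<and>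
    (\<forall>c\<in>carrier F. \<forall>x\<in>carrier L. \<forall>y\<in>carrier M. b (c \<odot>\<^bsub>L\<^esub> x) y = c \<odot>\<^bsub>N\<^esub> b x y)"
  unfolding bilinear_maps_def linear_maps_iff by auto

lemma bilinear_mapsD:
  assumes "b \<in> bilinear_maps F L M N"
  shows "\<lbrakk>x \<in> carrier L; y \<in> carrier M\<rbrakk> \<Longrightarrow> b x y \<in> carrier N"
    and "\<lbrakk>x \<in> carrier L; y \<in> carrier M; y' \<in> carrier M\<rbrakk> \<Longrightarrow> b x (y \<oplus>\<^bsub>M\<^esub> y') = b x y \<oplus>\<^bsub>N\<^esub> b x y'"
    and "\<lbrakk>x \<in> carrier L; x' \<in> carrier L; y \<in> carrier M\<rbrakk> \<Longrightarrow> b (x \<oplus>\<^bsub>L\<^esub> x') y = b x y \<oplus>\<^bsub>N\<^esub> b x' y"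
    and "\<lbrakk>c \<in> carrier F; x \<in> carrier L; y \<in> carrier M\<rbrakk> \<Longrightarrow> b x (c \<odot>\<^bsub>M\<^esub> y) = c \<odot>\<^bsub>N\<^esub> b x y"
    and "\<lbrakk>c \<in> carrier F; x \<in> carrier L; y \<in> carrier M\<rbrakk> \<Longrightarrow> b (c \<odot>\<^bsub>L\<^esub> x) y = c \<odot>\<^bsub>N\<^esub> b x y"
  using assms by (simp_all add: bilinear_maps_iff)

lemma bilinear_maps_zero:
  assumes "module F L" "module F M" "module F N" "b \<in> bilinear_maps F L M N"
  shows "x \<in> carrier L \<Longrightarrow> b x \<zero>\<^bsub>M\<^esub> = \<zero>\<^bsub>N\<^esub>" and "y \<in> carrier M \<Longrightarrow> b \<zero>\<^bsub>L\<^esub> y = \<zero>\<^bsub>N\<^esub>"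
  using linear_maps_zero[of F M N "b x"] linear_maps_zero[of F L N "\<lambda>x. b x y"] assms
  by (auto simp: bilinear_maps_def)

section \<open>KV-modules\<close>

lemma kv_algebra_module: "kv_algebra F A \<Longrightarrow> module F A"
  by (simp add: kv_algebra_def)

text \<open>The associator identities are rewritten as equations between sums: in this form a map that preserves
addition and the actions reflects them, without any statement about additive inverses.\<close>

lemma kv_module_iff:
  "kv_module F A W \<longleftrightarrow> kv_algebra F A \<and> module F W \<and>
     lact W \<in> bilinear_maps F A W W \<and> ract W \<in> bilinear_maps F W A W \<and>
     (\<forall>a\<in>carrier A. \<forall>b\<in>carrier A. \<forall>w\<in>carrier W.
        lact W (a \<otimes>\<^bsub>A\<^esub> b) w \<oplus>\<^bsub>W\<^esub> lact W b (lact W a w) =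
        lact W (b \<otimes>\<^bsub>A\<^esub> a) w \<oplus>\<^bsub>W\<^esub> lact W a (lact W b w)) \<and>
     (\<forall>a\<in>carrier A. \<forall>b\<in>carrier A. \<forall>w\<in>carrier W.
        ract W (lact W a w) b \<oplus>\<^bsub>W\<^esub> ract W w (a \<otimes>\<^bsub>A\<^esub> b) =
        ract W (ract W w a) b \<oplus>\<^bsub>W\<^esub> lact W a (ract W w b))"
  (is "?L \<longleftrightarrow> ?alg \<and> ?mod \<and> ?l \<and> ?r \<and> ?abw \<and> ?awb")
proof (cases "?alg \<and> ?mod \<and> ?l \<and> ?r")
  case True
  then interpret A: kv_algebra F A by simp
  interpret W: module F W using True by simp
  have A: "\<And>a b. \<lbrakk>a \<in> carrier A; b \<in> carrier A\<rbrakk> \<Longrightarrow> a \<otimes>\<^bsub>A\<^esub> b \<in> carrier A"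
    using A.mult_bilinear by (simp add: bilinear_maps_iff)
  have W: "\<And>a w. \<lbrakk>a \<in> carrier A; w \<in> carrier W\<rbrakk> \<Longrightarrow> lact W a w \<in> carrier W"
      "\<And>a w. \<lbrakk>a \<in> carrier A; w \<in> carrier W\<rbrakk> \<Longrightarrow> ract W w a \<in> carrier W"
    using True by (simp_all add: bilinear_maps_iff)
  show ?thesis
    using True unfolding kv_module_def kv_module_axioms_def
    by (simp add: A W W.M.minus_eq_minus_iff Ball_def)
qed (auto simp: kv_module_def kv_module_axioms_def)

lemma kv_moduleD:
  assumes "kv_module F A W"
  shows "kv_algebra F A" "module F W" "module F A"
    and "a \<in> carrier A \<Longrightarrow> b \<in> carrier A \<Longrightarrow> a \<otimes>\<^bsub>A\<^esub> b \<in> carrier A"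
    and "a \<in> carrier A \<Longrightarrow> w \<in> carrier W \<Longrightarrow> lact W a w \<in> carrier W"
    and "a \<in> carrier A \<Longrightarrow> w \<in> carrier W \<Longrightarrow> ract W w a \<in> carrier W"
  using assms kv_algebra.mult_bilinear[of F A] unfolding kv_module_iff
  by (auto simp: kv_algebra_module bilinear_maps_iff)

lemma (in kv_module) lact_linear:
  shows "\<lbrakk>a \<in> carrier A; x \<in> carrier W; y \<in> carrier W\<rbrakk> \<Longrightarrow> lact W a (x \<oplus>\<^bsub>W\<^esub> y) = lact W a x \<oplus>\<^bsub>W\<^esub> lact W a y"
    and "\<lbrakk>a \<in> carrier A; b \<in> carrier A; x \<in> carrier W\<rbrakk> \<Longrightarrow> lact W (a \<oplus>\<^bsub>A\<^esub> b) x = lact W a x \<oplus>\<^bsub>W\<^esub> lact W b x"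
    and "\<lbrakk>c \<in> carrier F; a \<in> carrier A; x \<in> carrier W\<rbrakk> \<Longrightarrow> lact W a (c \<odot>\<^bsub>W\<^esub> x) = c \<odot>\<^bsub>W\<^esub> lact W a x"
    and "\<lbrakk>c \<in> carrier F; a \<in> carrier A; x \<in> carrier W\<rbrakk> \<Longrightarrow> lact W (c \<odot>\<^bsub>A\<^esub> a) x = c \<odot>\<^bsub>W\<^esub> lact W a x"
    and "a \<in> carrier A \<Longrightarrow> lact W a \<zero>\<^bsub>W\<^esub> = \<zero>\<^bsub>W\<^esub>"
    and "x \<in> carrier W \<Longrightarrow> lact W \<zero>\<^bsub>A\<^esub> x = \<zero>\<^bsub>W\<^esub>"
  using lact_bilinear bilinear_maps_zero[OF _ _ _ lact_bilinear] kv_moduleD(2,3)[OF kv_module_axioms]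
  by (simp_all add: bilinear_maps_iff)

lemma (in kv_module) ract_linear:
  shows "\<lbrakk>a \<in> carrier A; x \<in> carrier W; y \<in> carrier W\<rbrakk> \<Longrightarrow> ract W (x \<oplus>\<^bsub>W\<^esub> y) a = ract W x a \<oplus>\<^bsub>W\<^esub> ract W y a"
    and "\<lbrakk>a \<in> carrier A; b \<in> carrier A; x \<in> carrier W\<rbrakk> \<Longrightarrow> ract W x (a \<oplus>\<^bsub>A\<^esub> b) = ract W x a \<oplus>\<^bsub>W\<^esub> ract W x b"
    and "\<lbrakk>c \<in> carrier F; a \<in> carrier A; x \<in> carrier W\<rbrakk> \<Longrightarrow> ract W (c \<odot>\<^bsub>W\<^esub> x) a = c \<odot>\<^bsub>W\<^esub> ract W x a"
    and "\<lbrakk>c \<in> carrier F; a \<in> carrier A; x \<in> carrier W\<rbrakk> \<Longrightarrow> ract W x (c \<odot>\<^bsub>A\<^esub> a) = c \<odot>\<^bsub>W\<^esub> ract W x a"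
    and "a \<in> carrier A \<Longrightarrow> ract W \<zero>\<^bsub>W\<^esub> a = \<zero>\<^bsub>W\<^esub>"
    and "x \<in> carrier W \<Longrightarrow> ract W x \<zero>\<^bsub>A\<^esub> = \<zero>\<^bsub>W\<^esub>"
  using ract_bilinear bilinear_maps_zero[OF _ _ _ ract_bilinear] kv_moduleD(2,3)[OF kv_module_axioms]
  by (simp_all add: bilinear_maps_iff)

text \<open>Equational axioms pull back along an injective map that preserves the operations. Additive inverses
exist in \<open>M\<close> because \<open>(-1) x\<close> does.\<close>

lemma module_transport:
  assumes T: "module F T" and inj: "inj_on g (carrier M)"
    and zero: "\<zero>\<^bsub>M\<^esub> \<in> carrier M" "g \<zero>\<^bsub>M\<^esub> = \<zero>\<^bsub>T\<^esub>"
    and add: "\<And>x y. \<lbrakk>x \<in> carrier M; y \<in> carrier M\<rbrakk> \<Longrightarrow> x \<oplus>\<^bsub>M\<^esub> y \<in> carrier M"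
    and smult: "\<And>c x. \<lbrakk>c \<in> carrier F; x \<in> carrier M\<rbrakk> \<Longrightarrow> c \<odot>\<^bsub>M\<^esub> x \<in> carrier M"
    and g: "g \<in> linear_maps F M T"
  shows "module F M"
proof -
  interpret T: module F T by fact
  note [simp] = zero add smult
  have [simp]: "\<And>x. x \<in> carrier M \<Longrightarrow> g x \<in> carrier T"
    "\<And>x y. \<lbrakk>x \<in> carrier M; y \<in> carrier M\<rbrakk> \<Longrightarrow> g (x \<oplus>\<^bsub>M\<^esub> y) = g x \<oplus>\<^bsub>T\<^esub> g y"
    "\<And>c x. \<lbrakk>c \<in> carrier F; x \<in> carrier M\<rbrakk> \<Longrightarrow> g (c \<odot>\<^bsub>M\<^esub> x) = c \<odot>\<^bsub>T\<^esub> g x"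
    using g by (simp_all add: linear_maps_iff)
  have eqI: "\<And>x y. \<lbrakk>g x = g y; x \<in> carrier M; y \<in> carrier M\<rbrakk> \<Longrightarrow> x = y"
    using inj by (simp add: inj_onD)
  have "abelian_group M"
  proof (rule abelian_groupI)
    fix x assume "x \<in> carrier M"
    then show "\<exists>y\<in>carrier M. y \<oplus>\<^bsub>M\<^esub> x = \<zero>\<^bsub>M\<^esub>"
      by (intro bexI[of _ "(\<ominus>\<^bsub>F\<^esub> \<one>\<^bsub>F\<^esub>) \<odot>\<^bsub>M\<^esub> x"] eqI)
        (simp_all add: T.smult_l_minus T.M.l_neg)
  qed (auto intro!: eqI simp: T.M.a_ac)
  then show ?thesis
    by (rule moduleI[OF T.R.is_cring])
      (auto intro!: eqI simp: T.smult_l_distr T.smult_r_distr T.smult_assoc1)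
qed

lemma kv_module_transport:
  assumes T: "kv_module F A T" and inj: "inj_on g (carrier M)"
    and zero: "\<zero>\<^bsub>M\<^esub> \<in> carrier M" "g \<zero>\<^bsub>M\<^esub> = \<zero>\<^bsub>T\<^esub>"
    and add: "\<And>x y. \<lbrakk>x \<in> carrier M; y \<in> carrier M\<rbrakk> \<Longrightarrow> x \<oplus>\<^bsub>M\<^esub> y \<in> carrier M"
    and smult: "\<And>c x. \<lbrakk>c \<in> carrier F; x \<in> carrier M\<rbrakk> \<Longrightarrow> c \<odot>\<^bsub>M\<^esub> x \<in> carrier M"
    and act: "\<And>a x. \<lbrakk>a \<in> carrier A; x \<in> carrier M\<rbrakk> \<Longrightarrow> lact M a x \<in> carrier M"
      "\<And>a x. \<lbrakk>a \<in> carrier A; x \<in> carrier M\<rbrakk> \<Longrightarrow> ract M x a \<in> carrier M"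
    and g: "g \<in> kv_hom F A M T"
  shows "kv_module F A M"
proof -
  interpret T: kv_module F A T by fact
  have lin: "g \<in> linear_maps F M T" using g by (simp add: kv_hom_def)
  note [simp] = zero add smult act kv_moduleD(4)[OF T]
  have [simp]: "\<And>x. x \<in> carrier M \<Longrightarrow> g x \<in> carrier T"
    "\<And>x y. \<lbrakk>x \<in> carrier M; y \<in> carrier M\<rbrakk> \<Longrightarrow> g (x \<oplus>\<^bsub>M\<^esub> y) = g x \<oplus>\<^bsub>T\<^esub> g y"
    "\<And>c x. \<lbrakk>c \<in> carrier F; x \<in> carrier M\<rbrakk> \<Longrightarrow> g (c \<odot>\<^bsub>M\<^esub> x) = c \<odot>\<^bsub>T\<^esub> g x"
    "\<And>a x. \<lbrakk>a \<in> carrier A; x \<in> carrier M\<rbrakk> \<Longrightarrow> g (lact M a x) = lact T a (g x)"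
    "\<And>a x. \<lbrakk>a \<in> carrier A; x \<in> carrier M\<rbrakk> \<Longrightarrow> g (ract M x a) = ract T (g x) a"
    using g by (simp_all add: linear_maps_iff kv_hom_def)
  have eqI: "\<And>x y. \<lbrakk>g x = g y; x \<in> carrier M; y \<in> carrier M\<rbrakk> \<Longrightarrow> x = y"
    using inj by (simp add: inj_onD)
  interpret A: module F A by (rule kv_moduleD[OF T])
  have "module F M" by (rule module_transport[OF kv_moduleD(2)[OF T] inj]) (use lin in simp_all)
  moreover have "lact M \<in> bilinear_maps F A M M"
    using T.lact_bilinear unfolding bilinear_maps_iff by (auto intro!: eqI)
  moreover have "ract M \<in> bilinear_maps F M A M"
    using T.ract_bilinear unfolding bilinear_maps_iff by (auto intro!: eqI)
  ultimately show ?thesis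
    using T unfolding kv_module_iff by (auto intro!: eqI)
qed

section \<open>Extensions with underlying space \<open>V \<times> W\<close>\<close>

definition twisted_sum ::
    "('f, 'a, 'v, 'u) kv_mod_scheme \<Rightarrow> ('f, 'a, 'w, 'y) kv_mod_scheme
      \<Rightarrow> ('a \<Rightarrow> 'w \<Rightarrow> 'v) \<Rightarrow> ('w \<Rightarrow> 'a \<Rightarrow> 'v) \<Rightarrow> ('f, 'a, 'v \<times> 'w) kv_mod" where
  "twisted_sum V W \<phi> \<psi> = \<lparr>carrier = carrier V \<times> carrier W,
     mult = undefined, one = undefined,
     zero = (\<zero>\<^bsub>V\<^esub>, \<zero>\<^bsub>W\<^esub>),
     add = (\<lambda>(v, w) (v', w'). (v \<oplus>\<^bsub>V\<^esub> v', w \<oplus>\<^bsub>W\<^esub> w')),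
     smult = (\<lambda>c (v, w). (c \<odot>\<^bsub>V\<^esub> v, c \<odot>\<^bsub>W\<^esub> w)),
     lact = (\<lambda>a (v, w). (lact V a v \<oplus>\<^bsub>V\<^esub> \<phi> a w, lact W a w)),
     ract = (\<lambda>(v, w) a. (ract V v a \<oplus>\<^bsub>V\<^esub> \<psi> w a, ract W w a))\<rparr>"

lemma twisted_sum_simps [simp]:
  "carrier (twisted_sum V W \<phi> \<psi>) = carrier V \<times> carrier W"
  "zero (twisted_sum V W \<phi> \<psi>) = (\<zero>\<^bsub>V\<^esub>, \<zero>\<^bsub>W\<^esub>)"
  "(v, w) \<oplus>\<^bsub>twisted_sum V W \<phi> \<psi>\<^esub> (v', w') = (v \<oplus>\<^bsub>V\<^esub> v', w \<oplus>\<^bsub>W\<^esub> w')"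
  "c \<odot>\<^bsub>twisted_sum V W \<phi> \<psi>\<^esub> (v, w) = (c \<odot>\<^bsub>V\<^esub> v, c \<odot>\<^bsub>W\<^esub> w)"
  "lact (twisted_sum V W \<phi> \<psi>) a (v, w) = (lact V a v \<oplus>\<^bsub>V\<^esub> \<phi> a w, lact W a w)"
  "ract (twisted_sum V W \<phi> \<psi>) (v, w) a = (ract V v a \<oplus>\<^bsub>V\<^esub> \<psi> w a, ract W w a)"
  by (simp_all add: twisted_sum_def)

text \<open>The two equations are the parts of the KV-module identities of \<open>twisted_sum\<close> with values in \<open>V\<close>, after
cancellation of the terms that come from the identities of \<open>V\<close>, and with all negative terms moved to
the other side.\<close>

definition extension_cocycle ::
    "('f, 'z) ring_scheme \<Rightarrow> ('f, 'a, 'x) module_scheme \<Rightarrow> ('f, 'a, 'w, 'y) kv_mod_scheme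
      \<Rightarrow> ('f, 'a, 'v, 'u) kv_mod_scheme \<Rightarrow> ('a \<Rightarrow> 'w \<Rightarrow> 'v) \<Rightarrow> ('w \<Rightarrow> 'a \<Rightarrow> 'v) \<Rightarrow> bool" where
  "extension_cocycle F A W V \<phi> \<psi> \<longleftrightarrow>
     \<phi> \<in> bilinear_maps F A W V \<and> \<psi> \<in> bilinear_maps F W A V \<and>
     (\<forall>a\<in>carrier A. \<forall>b\<in>carrier A. \<forall>w\<in>carrier W.
        \<phi> (a \<otimes>\<^bsub>A\<^esub> b) w \<oplus>\<^bsub>V\<^esub> (lact V b (\<phi> a w) \<oplus>\<^bsub>V\<^esub> \<phi> b (lact W a w)) =
        \<phi> (b \<otimes>\<^bsub>A\<^esub> a) w \<oplus>\<^bsub>V\<^esub> (lact V a (\<phi> b w) \<oplus>\<^bsub>V\<^esub> \<phi> a (lact W b w))) \<and>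
     (\<forall>a\<in>carrier A. \<forall>b\<in>carrier A. \<forall>w\<in>carrier W.
        (ract V (\<phi> a w) b \<oplus>\<^bsub>V\<^esub> \<psi> (lact W a w) b) \<oplus>\<^bsub>V\<^esub> \<psi> w (a \<otimes>\<^bsub>A\<^esub> b) =
        (ract V (\<psi> w a) b \<oplus>\<^bsub>V\<^esub> \<psi> (ract W w a) b) \<oplus>\<^bsub>V\<^esub>
          (lact V a (\<psi> w b) \<oplus>\<^bsub>V\<^esub> \<phi> a (ract W w b)))"

lemma twisted_sum_module:
  assumes "module F V" "module F W"
  shows "module F (twisted_sum V W \<phi> \<psi>)"
proof -
  interpret V: module F V by fact
  interpret W: module F W by fact
  have "abelian_group (twisted_sum V W \<phi> \<psi>)"
  proof (rule abelian_groupI)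
    fix x assume "x \<in> carrier (twisted_sum V W \<phi> \<psi>)"
    then obtain v w where x: "x = (v, w)" "v \<in> carrier V" "w \<in> carrier W" by auto
    then show "\<exists>y\<in>carrier (twisted_sum V W \<phi> \<psi>).
        y \<oplus>\<^bsub>twisted_sum V W \<phi> \<psi>\<^esub> x = \<zero>\<^bsub>twisted_sum V W \<phi> \<psi>\<^esub>"
      by (intro bexI[of _ "(\<ominus>\<^bsub>V\<^esub> v, \<ominus>\<^bsub>W\<^esub> w)"]) (simp_all add: V.M.l_neg W.M.l_neg)
  qed (auto simp: V.M.a_ac W.M.a_ac)
  then show ?thesis
    by (rule moduleI[OF V.R.is_cring])
      (auto simp: V.smult_l_distr V.smult_r_distr V.smult_assoc1
        W.smult_l_distr W.smult_r_distr W.smult_assoc1)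
qed

locale kv_module_pair = W: kv_module F A W + V: kv_module F A V
  for F :: "('f, 'z) ring_scheme" and A :: "('f, 'a, 'x) module_scheme"
    and W :: "('f, 'a, 'w, 'y) kv_mod_scheme" and V :: "('f, 'a, 'v, 'u) kv_mod_scheme"
begin

lemmas W_module = kv_moduleD(2)[OF W.kv_module_axioms]
lemmas V_module = kv_moduleD(2)[OF V.kv_module_axioms]
lemmas A_module = kv_moduleD(3)[OF W.kv_module_axioms]

sublocale A: module F A by (rule A_module)

lemmas act_closed [simp] =
  kv_moduleD(4-6)[OF W.kv_module_axioms] kv_moduleD(5,6)[OF V.kv_module_axioms]

lemmas act_linear =
  V.lact_linear V.ract_linear W.lact_linear W.ract_linear

text \<open>Restricting the action to \<open>{0} \<times> W\<close> isolates \<open>\<phi>\<close>. The values of \<open>\<phi>\<close> must lie in \<open>V\<close> from the outset,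
because \<open>a v + \<phi>(a, w)\<close> can lie in the carrier of \<open>V\<close> without \<open>\<phi>(a, w)\<close> doing so.\<close>

lemma lact_twisted_sum_bilinear_iff:
  assumes "\<And>a w. \<lbrakk>a \<in> carrier A; w \<in> carrier W\<rbrakk> \<Longrightarrow> \<phi> a w \<in> carrier V"
  shows "lact (twisted_sum V W \<phi> \<psi>) \<in> bilinear_maps F A (twisted_sum V W \<phi> \<psi>) (twisted_sum V W \<phi> \<psi>)
     \<longleftrightarrow> \<phi> \<in> bilinear_maps F A W V" (is "?L \<longleftrightarrow> ?R")
proof
  let ?T = "twisted_sum V W \<phi> \<psi>"
  assume L: ?L
  have *: "lact ?T a (\<zero>\<^bsub>V\<^esub>, w) = (\<phi> a w, lact W a w)" if "a \<in> carrier A" "w \<in> carrier W" for a w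
    using that assms by (simp add: act_linear)
  show ?R
    unfolding bilinear_maps_iff
  proof (intro conjI ballI)
    fix a w w' assume aw: "a \<in> carrier A" "w \<in> carrier W" "w' \<in> carrier W"
    then have "lact ?T a ((\<zero>\<^bsub>V\<^esub>, w) \<oplus>\<^bsub>?T\<^esub> (\<zero>\<^bsub>V\<^esub>, w')) = lact ?T a (\<zero>\<^bsub>V\<^esub>, w) \<oplus>\<^bsub>?T\<^esub> lact ?T a (\<zero>\<^bsub>V\<^esub>, w')"
      using bilinear_mapsD(2)[OF L, of a "(\<zero>\<^bsub>V\<^esub>, w)" "(\<zero>\<^bsub>V\<^esub>, w')"] by simp
    then show "\<phi> a (w \<oplus>\<^bsub>W\<^esub> w') = \<phi> a w \<oplus>\<^bsub>V\<^esub> \<phi> a w'" using aw by (simp add: * assms act_linear)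
  next
    fix a a' w assume aw: "a \<in> carrier A" "a' \<in> carrier A" "w \<in> carrier W"
    then have "lact ?T (a \<oplus>\<^bsub>A\<^esub> a') (\<zero>\<^bsub>V\<^esub>, w) = lact ?T a (\<zero>\<^bsub>V\<^esub>, w) \<oplus>\<^bsub>?T\<^esub> lact ?T a' (\<zero>\<^bsub>V\<^esub>, w)"
      using bilinear_mapsD(3)[OF L, of a a' "(\<zero>\<^bsub>V\<^esub>, w)"] by simp
    then show "\<phi> (a \<oplus>\<^bsub>A\<^esub> a') w = \<phi> a w \<oplus>\<^bsub>V\<^esub> \<phi> a' w" using aw by (simp add: * assms act_linear)
  next
    fix c a w assume aw: "c \<in> carrier F" "a \<in> carrier A" "w \<in> carrier W"
    then have "lact ?T a (c \<odot>\<^bsub>?T\<^esub> (\<zero>\<^bsub>V\<^esub>, w)) = c \<odot>\<^bsub>?T\<^esub> lact ?T a (\<zero>\<^bsub>V\<^esub>, w)"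
      "lact ?T (c \<odot>\<^bsub>A\<^esub> a) (\<zero>\<^bsub>V\<^esub>, w) = c \<odot>\<^bsub>?T\<^esub> lact ?T a (\<zero>\<^bsub>V\<^esub>, w)"
      using bilinear_mapsD(4,5)[OF L, of c a "(\<zero>\<^bsub>V\<^esub>, w)"] by simp_all
    then show "\<phi> a (c \<odot>\<^bsub>W\<^esub> w) = c \<odot>\<^bsub>V\<^esub> \<phi> a w" "\<phi> (c \<odot>\<^bsub>A\<^esub> a) w = c \<odot>\<^bsub>V\<^esub> \<phi> a w"
      using aw by (simp_all add: * assms act_linear)
  qed (use assms in simp)
next
  assume ?R
  from bilinear_mapsD[OF this] show ?L
    unfolding bilinear_maps_iff by (auto simp: act_linear V.W.smult_r_distr V.W.M.a_ac)
qed

lemma ract_twisted_sum_bilinear_iff: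
  assumes "\<And>a w. \<lbrakk>a \<in> carrier A; w \<in> carrier W\<rbrakk> \<Longrightarrow> \<psi> w a \<in> carrier V"
  shows "ract (twisted_sum V W \<phi> \<psi>) \<in> bilinear_maps F (twisted_sum V W \<phi> \<psi>) A (twisted_sum V W \<phi> \<psi>)
     \<longleftrightarrow> \<psi> \<in> bilinear_maps F W A V" (is "?L \<longleftrightarrow> ?R")
proof
  let ?T = "twisted_sum V W \<phi> \<psi>"
  assume L: ?L
  have *: "ract ?T (\<zero>\<^bsub>V\<^esub>, w) a = (\<psi> w a, ract W w a)" if "a \<in> carrier A" "w \<in> carrier W" for a w
    using that assms by (simp add: act_linear)
  show ?R
    unfolding bilinear_maps_iff
  proof (intro conjI ballI)
    fix a w w' assume aw: "w \<in> carrier W" "w' \<in> carrier W" "a \<in> carrier A"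
    then have "ract ?T ((\<zero>\<^bsub>V\<^esub>, w) \<oplus>\<^bsub>?T\<^esub> (\<zero>\<^bsub>V\<^esub>, w')) a = ract ?T (\<zero>\<^bsub>V\<^esub>, w) a \<oplus>\<^bsub>?T\<^esub> ract ?T (\<zero>\<^bsub>V\<^esub>, w') a"
      using bilinear_mapsD(3)[OF L, of "(\<zero>\<^bsub>V\<^esub>, w)" "(\<zero>\<^bsub>V\<^esub>, w')" a] by simp
    then show "\<psi> (w \<oplus>\<^bsub>W\<^esub> w') a = \<psi> w a \<oplus>\<^bsub>V\<^esub> \<psi> w' a" using aw by (simp add: * assms act_linear)
  next
    fix a a' w assume aw: "w \<in> carrier W" "a \<in> carrier A" "a' \<in> carrier A"
    then have "ract ?T (\<zero>\<^bsub>V\<^esub>, w) (a \<oplus>\<^bsub>A\<^esub> a') = ract ?T (\<zero>\<^bsub>V\<^esub>, w) a \<oplus>\<^bsub>?T\<^esub> ract ?T (\<zero>\<^bsub>V\<^esub>, w) a'"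
      using bilinear_mapsD(2)[OF L, of "(\<zero>\<^bsub>V\<^esub>, w)" a a'] by simp
    then show "\<psi> w (a \<oplus>\<^bsub>A\<^esub> a') = \<psi> w a \<oplus>\<^bsub>V\<^esub> \<psi> w a'" using aw by (simp add: * assms act_linear)
  next
    fix c a w assume aw: "c \<in> carrier F" "w \<in> carrier W" "a \<in> carrier A"
    then have "ract ?T (c \<odot>\<^bsub>?T\<^esub> (\<zero>\<^bsub>V\<^esub>, w)) a = c \<odot>\<^bsub>?T\<^esub> ract ?T (\<zero>\<^bsub>V\<^esub>, w) a"
      "ract ?T (\<zero>\<^bsub>V\<^esub>, w) (c \<odot>\<^bsub>A\<^esub> a) = c \<odot>\<^bsub>?T\<^esub> ract ?T (\<zero>\<^bsub>V\<^esub>, w) a"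
      using bilinear_mapsD(4,5)[OF L, of c "(\<zero>\<^bsub>V\<^esub>, w)" a] by simp_all
    then show "\<psi> (c \<odot>\<^bsub>W\<^esub> w) a = c \<odot>\<^bsub>V\<^esub> \<psi> w a" "\<psi> w (c \<odot>\<^bsub>A\<^esub> a) = c \<odot>\<^bsub>V\<^esub> \<psi> w a"
      using aw by (simp_all add: * assms act_linear)
  qed (use assms in simp)
next
  assume ?R
  from bilinear_mapsD[OF this] show ?L
    unfolding bilinear_maps_iff by (auto simp: act_linear V.W.smult_r_distr V.W.M.a_ac)
qed

text \<open>In each identity the \<open>W\<close>-component is the identity of \<open>W\<close>, and in the \<open>V\<close>-component the terms that
contain \<open>v\<close> form the identity of \<open>V\<close>; what remains is the cocycle equation.\<close>

lemma twisted_sum_kv_module_iff: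
  assumes \<phi>: "\<And>a w. \<lbrakk>a \<in> carrier A; w \<in> carrier W\<rbrakk> \<Longrightarrow> \<phi> a w \<in> carrier V"
    and \<psi>: "\<And>a w. \<lbrakk>a \<in> carrier A; w \<in> carrier W\<rbrakk> \<Longrightarrow> \<psi> w a \<in> carrier V"
  shows "kv_module F A (twisted_sum V W \<phi> \<psi>) \<longleftrightarrow> extension_cocycle F A W V \<phi> \<psi>"
proof -
  let ?T = "twisted_sum V W \<phi> \<psi>"
  have V1: "lact V (a \<otimes>\<^bsub>A\<^esub> b) v \<oplus>\<^bsub>V\<^esub> lact V b (lact V a v) = lact V (b \<otimes>\<^bsub>A\<^esub> a) v \<oplus>\<^bsub>V\<^esub> lact V a (lact V b v)"
    and V2: "ract V (lact V a v) b \<oplus>\<^bsub>V\<^esub> ract V v (a \<otimes>\<^bsub>A\<^esub> b) = ract V (ract V v a) b \<oplus>\<^bsub>V\<^esub> lact V a (ract V v b)"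
    if "a \<in> carrier A" "b \<in> carrier A" "v \<in> carrier V" for a b v
    using V.kv_module_axioms that unfolding kv_module_iff by blast+
  have W1: "lact W (a \<otimes>\<^bsub>A\<^esub> b) v \<oplus>\<^bsub>W\<^esub> lact W b (lact W a v) = lact W (b \<otimes>\<^bsub>A\<^esub> a) v \<oplus>\<^bsub>W\<^esub> lact W a (lact W b v)"
    and W2: "ract W (lact W a v) b \<oplus>\<^bsub>W\<^esub> ract W v (a \<otimes>\<^bsub>A\<^esub> b) = ract W (ract W v a) b \<oplus>\<^bsub>W\<^esub> lact W a (ract W v b)"
    if "a \<in> carrier A" "b \<in> carrier A" "v \<in> carrier W" for a b v
    using W.kv_module_axioms that unfolding kv_module_iff by blast+
  \<comment> \<open>terms containing \<open>v\<close> are \<open>p, q, r, s\<close>; they drop out by the identities of \<open>V\<close>\<close>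
  have cancel: "(p \<oplus>\<^bsub>V\<^esub> x) \<oplus>\<^bsub>V\<^esub> (q \<oplus>\<^bsub>V\<^esub> y) = (r \<oplus>\<^bsub>V\<^esub> x') \<oplus>\<^bsub>V\<^esub> (s \<oplus>\<^bsub>V\<^esub> y') \<longleftrightarrow> x \<oplus>\<^bsub>V\<^esub> y = x' \<oplus>\<^bsub>V\<^esub> y'"
    if "p \<oplus>\<^bsub>V\<^esub> q = r \<oplus>\<^bsub>V\<^esub> s"
      "p \<in> carrier V" "q \<in> carrier V" "r \<in> carrier V" "s \<in> carrier V"
      "x \<in> carrier V" "y \<in> carrier V" "x' \<in> carrier V" "y' \<in> carrier V" for p q r s x y x' y'
  proof -
    have "(p \<oplus>\<^bsub>V\<^esub> x) \<oplus>\<^bsub>V\<^esub> (q \<oplus>\<^bsub>V\<^esub> y) = (p \<oplus>\<^bsub>V\<^esub> q) \<oplus>\<^bsub>V\<^esub> (x \<oplus>\<^bsub>V\<^esub> y)"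
      "(r \<oplus>\<^bsub>V\<^esub> x') \<oplus>\<^bsub>V\<^esub> (s \<oplus>\<^bsub>V\<^esub> y') = (r \<oplus>\<^bsub>V\<^esub> s) \<oplus>\<^bsub>V\<^esub> (x' \<oplus>\<^bsub>V\<^esub> y')"
      using that(2-) by (simp_all add: V.W.M.a_ac)
    then show ?thesis using that by simp
  qed
  have abw: "lact ?T (a \<otimes>\<^bsub>A\<^esub> b) x \<oplus>\<^bsub>?T\<^esub> lact ?T b (lact ?T a x) =
        lact ?T (b \<otimes>\<^bsub>A\<^esub> a) x \<oplus>\<^bsub>?T\<^esub> lact ?T a (lact ?T b x) \<longleftrightarrow>
      \<phi> (a \<otimes>\<^bsub>A\<^esub> b) w \<oplus>\<^bsub>V\<^esub> (lact V b (\<phi> a w) \<oplus>\<^bsub>V\<^esub> \<phi> b (lact W a w)) =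
      \<phi> (b \<otimes>\<^bsub>A\<^esub> a) w \<oplus>\<^bsub>V\<^esub> (lact V a (\<phi> b w) \<oplus>\<^bsub>V\<^esub> \<phi> a (lact W b w))"
    if *: "a \<in> carrier A" "b \<in> carrier A" "v \<in> carrier V" "w \<in> carrier W" "x = (v, w)" for a b v w x
  proof -
    have split: "lact ?T (a \<otimes>\<^bsub>A\<^esub> b) x \<oplus>\<^bsub>?T\<^esub> lact ?T b (lact ?T a x) =
        ((lact V (a \<otimes>\<^bsub>A\<^esub> b) v \<oplus>\<^bsub>V\<^esub> \<phi> (a \<otimes>\<^bsub>A\<^esub> b) w) \<oplus>\<^bsub>V\<^esub>
           (lact V b (lact V a v) \<oplus>\<^bsub>V\<^esub> (lact V b (\<phi> a w) \<oplus>\<^bsub>V\<^esub> \<phi> b (lact W a w))),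
         lact W (a \<otimes>\<^bsub>A\<^esub> b) w \<oplus>\<^bsub>W\<^esub> lact W b (lact W a w))"
      if "a \<in> carrier A" "b \<in> carrier A" for a b
      using that *(3-5) by (simp add: \<phi> act_linear V.W.M.a_assoc)
    show ?thesis
      unfolding split[OF *(1,2)] split[OF *(2,1)] prod.inject
      using * by (subst cancel[OF V1]) (simp_all add: \<phi> W1[of a b])
  qed
  have awb: "ract ?T (lact ?T a x) b \<oplus>\<^bsub>?T\<^esub> ract ?T x (a \<otimes>\<^bsub>A\<^esub> b) =
        ract ?T (ract ?T x a) b \<oplus>\<^bsub>?T\<^esub> lact ?T a (ract ?T x b) \<longleftrightarrow>
        (ract V (\<phi> a w) b \<oplus>\<^bsub>V\<^esub> \<psi> (lact W a w) b) \<oplus>\<^bsub>V\<^esub> \<psi> w (a \<otimes>\<^bsub>A\<^esub> b) =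
        (ract V (\<psi> w a) b \<oplus>\<^bsub>V\<^esub> \<psi> (ract W w a) b) \<oplus>\<^bsub>V\<^esub>
          (lact V a (\<psi> w b) \<oplus>\<^bsub>V\<^esub> \<phi> a (ract W w b))"
    if *: "a \<in> carrier A" "b \<in> carrier A" "v \<in> carrier V" "w \<in> carrier W" "x = (v, w)" for a b v w x
  proof -
    have l: "ract ?T (lact ?T a x) b \<oplus>\<^bsub>?T\<^esub> ract ?T x (a \<otimes>\<^bsub>A\<^esub> b) =
        ((ract V (lact V a v) b \<oplus>\<^bsub>V\<^esub> (ract V (\<phi> a w) b \<oplus>\<^bsub>V\<^esub> \<psi> (lact W a w) b)) \<oplus>\<^bsub>V\<^esub>
           (ract V v (a \<otimes>\<^bsub>A\<^esub> b) \<oplus>\<^bsub>V\<^esub> \<psi> w (a \<otimes>\<^bsub>A\<^esub> b)),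
         ract W (lact W a w) b \<oplus>\<^bsub>W\<^esub> ract W w (a \<otimes>\<^bsub>A\<^esub> b))"
      using * by (simp add: \<phi> \<psi> act_linear V.W.M.a_assoc)
    have r: "ract ?T (ract ?T x a) b \<oplus>\<^bsub>?T\<^esub> lact ?T a (ract ?T x b) =
        ((ract V (ract V v a) b \<oplus>\<^bsub>V\<^esub> (ract V (\<psi> w a) b \<oplus>\<^bsub>V\<^esub> \<psi> (ract W w a) b)) \<oplus>\<^bsub>V\<^esub>
           (lact V a (ract V v b) \<oplus>\<^bsub>V\<^esub> (lact V a (\<psi> w b) \<oplus>\<^bsub>V\<^esub> \<phi> a (ract W w b))),
         ract W (ract W w a) b \<oplus>\<^bsub>W\<^esub> lact W a (ract W w b))"
      using * by (simp add: \<phi> \<psi> act_linear V.W.M.a_assoc)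
    show ?thesis
      unfolding l r prod.inject
      using * by (subst cancel[OF V2]) (simp_all add: \<phi> \<psi> W2)
  qed
  have alg: "kv_algebra F A" by (rule kv_moduleD(1)[OF W.kv_module_axioms])
  have ex: "\<exists>v. v \<in> carrier V" using V.W.M.zero_closed by blast
  \<comment> \<open>the identities quantify over \<open>(v, w)\<close>, the cocycle equations over \<open>w\<close> only\<close>
  have pairs: "(\<forall>a\<in>carrier A. \<forall>b\<in>carrier A. \<forall>x\<in>carrier ?T. P a b x) \<longleftrightarrow>
      (\<forall>a\<in>carrier A. \<forall>b\<in>carrier A. \<forall>w\<in>carrier W. Q a b w)"
    if "\<And>a b v w x. \<lbrakk>a \<in> carrier A; b \<in> carrier A; v \<in> carrier V; w \<in> carrier W; x = (v, w)\<rbrakk>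
      \<Longrightarrow> P a b x \<longleftrightarrow> Q a b w" for P Q
    using that ex by auto
  have abw_all: "(\<forall>a\<in>carrier A. \<forall>b\<in>carrier A. \<forall>x\<in>carrier ?T.
        lact ?T (a \<otimes>\<^bsub>A\<^esub> b) x \<oplus>\<^bsub>?T\<^esub> lact ?T b (lact ?T a x) =
        lact ?T (b \<otimes>\<^bsub>A\<^esub> a) x \<oplus>\<^bsub>?T\<^esub> lact ?T a (lact ?T b x)) \<longleftrightarrow>
      (\<forall>a\<in>carrier A. \<forall>b\<in>carrier A. \<forall>w\<in>carrier W.
        \<phi> (a \<otimes>\<^bsub>A\<^esub> b) w \<oplus>\<^bsub>V\<^esub> (lact V b (\<phi> a w) \<oplus>\<^bsub>V\<^esub> \<phi> b (lact W a w)) =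
        \<phi> (b \<otimes>\<^bsub>A\<^esub> a) w \<oplus>\<^bsub>V\<^esub> (lact V a (\<phi> b w) \<oplus>\<^bsub>V\<^esub> \<phi> a (lact W b w)))"
    by (rule pairs) (rule abw)
  have awb_all: "(\<forall>a\<in>carrier A. \<forall>b\<in>carrier A. \<forall>x\<in>carrier ?T.
        ract ?T (lact ?T a x) b \<oplus>\<^bsub>?T\<^esub> ract ?T x (a \<otimes>\<^bsub>A\<^esub> b) =
        ract ?T (ract ?T x a) b \<oplus>\<^bsub>?T\<^esub> lact ?T a (ract ?T x b)) \<longleftrightarrow>
      (\<forall>a\<in>carrier A. \<forall>b\<in>carrier A. \<forall>w\<in>carrier W.
        (ract V (\<phi> a w) b \<oplus>\<^bsub>V\<^esub> \<psi> (lact W a w) b) \<oplus>\<^bsub>V\<^esub> \<psi> w (a \<otimes>\<^bsub>A\<^esub> b) =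
        (ract V (\<psi> w a) b \<oplus>\<^bsub>V\<^esub> \<psi> (ract W w a) b) \<oplus>\<^bsub>V\<^esub>
          (lact V a (\<psi> w b) \<oplus>\<^bsub>V\<^esub> \<phi> a (ract W w b)))"
    by (rule pairs) (rule awb)
  have lin: "lact ?T \<in> bilinear_maps F A ?T ?T \<longleftrightarrow> \<phi> \<in> bilinear_maps F A W V"
      "ract ?T \<in> bilinear_maps F ?T A ?T \<longleftrightarrow> \<psi> \<in> bilinear_maps F W A V"
    by (rule lact_twisted_sum_bilinear_iff ract_twisted_sum_bilinear_iff, erule (1) \<phi> \<psi>)+
  show ?thesis
    unfolding kv_module_iff extension_cocycle_def abw_all awb_all lin
    using alg twisted_sum_module[OF V_module W_module, of \<phi> \<psi>] by blast
qed

end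

section \<open>Cochains of low degree\<close>

lemma tuples_1_iff: "bs \<in> tuples B (Suc 0) \<longleftrightarrow> (\<exists>x\<in>carrier B. bs = [x])"
  by (auto simp: tuples_def length_Suc_conv)

lemma tuples_2_iff: "bs \<in> tuples B (Suc (Suc 0)) \<longleftrightarrow> (\<exists>x\<in>carrier B. \<exists>y\<in>carrier B. bs = [x, y])"
  by (auto simp: tuples_def length_Suc_conv)

lemma tuples_3_iff:
  "bs \<in> tuples B (Suc (Suc (Suc 0))) \<longleftrightarrow>
     (\<exists>x\<in>carrier B. \<exists>y\<in>carrier B. \<exists>z\<in>carrier B. bs = [x, y, z])"
  by (auto simp: tuples_def length_Suc_conv)

lemmas tuples_iff = tuples_1_iff tuples_2_iff tuples_3_iff

lemma ball_tuples:
  "(\<forall>bs\<in>tuples B (Suc 0). P bs) \<longleftrightarrow> (\<forall>x\<in>carrier B. P [x])"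
  "(\<forall>bs\<in>tuples B (Suc (Suc 0)). P bs) \<longleftrightarrow> (\<forall>x\<in>carrier B. \<forall>y\<in>carrier B. P [x, y])"
  "(\<forall>bs\<in>tuples B (Suc (Suc (Suc 0))). P bs) \<longleftrightarrow>
     (\<forall>x\<in>carrier B. \<forall>y\<in>carrier B. \<forall>z\<in>carrier B. P [x, y, z])"
  by (auto simp: tuples_iff)

lemma multilinear_maps_1_iff:
  "f \<in> multilinear_maps F B V (Suc 0) \<longleftrightarrow>
     f \<in> tuples B (Suc 0) \<rightarrow>\<^sub>E carrier V \<and> (\<lambda>x. f [x]) \<in> linear_maps F B V"
proof -
  have "(\<lambda>x. f [x]) \<in> linear_maps F B V" if "carrier B = {}" 
    using that by (simp add: linear_maps_iff)
  then show ?thesis by (auto simp: multilinear_maps_def ball_tuples)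
qed

lemma multilinear_maps_2_iff:
  "f \<in> multilinear_maps F B V (Suc (Suc 0)) \<longleftrightarrow>
     f \<in> tuples B (Suc (Suc 0)) \<rightarrow>\<^sub>E carrier V \<and> (\<lambda>x y. f [x, y]) \<in> bilinear_maps F B B V"
proof -
  have "(\<forall>bs\<in>tuples B (Suc (Suc 0)). \<forall>i<Suc (Suc 0). (\<lambda>x. f (bs[i := x])) \<in> linear_maps F B V) \<longleftrightarrow>
      (\<forall>x\<in>carrier B. \<forall>y\<in>carrier B.
        (\<lambda>y. f [x, y]) \<in> linear_maps F B V \<and> (\<lambda>x. f [x, y]) \<in> linear_maps F B V)"
    by (auto simp: ball_tuples less_Suc_eq all_conj_distrib)
  also have "\<dots> \<longleftrightarrow> (\<lambda>x y. f [x, y]) \<in> bilinear_maps F B B V"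
    unfolding bilinear_maps_def by auto
  finally show ?thesis by (simp add: multilinear_maps_def)
qed

lemma semidirect_simps [simp]:
  "carrier (semidirect A W) = carrier A \<times> carrier W"
  "zero (semidirect A W) = (\<zero>\<^bsub>A\<^esub>, \<zero>\<^bsub>W\<^esub>)"
  "(a, w) \<oplus>\<^bsub>semidirect A W\<^esub> (a', w') = (a \<oplus>\<^bsub>A\<^esub> a', w \<oplus>\<^bsub>W\<^esub> w')"
  "(a, w) \<otimes>\<^bsub>semidirect A W\<^esub> (a', w') = (a \<otimes>\<^bsub>A\<^esub> a', lact W a w' \<oplus>\<^bsub>W\<^esub> ract W w a')"
  "c \<odot>\<^bsub>semidirect A W\<^esub> (a, w) = (c \<odot>\<^bsub>A\<^esub> a, c \<odot>\<^bsub>W\<^esub> w)"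
  by (simp_all add: semidirect_def)

lemma inflate_simps [simp]:
  "carrier (inflate V) = carrier V" "zero (inflate V) = zero V" "add (inflate V) = add V"
  "smult (inflate V) = smult V"
  "lact (inflate V) (a, w) v = lact V a v" "ract (inflate V) v (a, w) = ract V v a"
  by (simp_all add: inflate_def)

lemma inflate_inv [simp]: "a_inv (inflate V) = a_inv V"
  by (simp add: a_inv_def m_inv_def fun_eq_iff)

lemma inflate_minus [simp]: "a_minus (inflate V) = a_minus V"
  by (simp add: a_minus_def fun_eq_iff)

lemma inflate_module:
  assumes "module F V"
  shows "module F (inflate V)"
proof -
  interpret V: module F V by fact
  show ?thesis
    by (rule module_transport[where g = "\<lambda>v. v", OF assms]) (simp_all add: linear_maps_iff)
qed

text \<open>The homogeneous cochain of bidegree \<open>(1,1)\<close> with components \<open>\<phi>\<close> and \<open>\<psi>\<close>, as a function on lists.\<close>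

definition bilinear_cochain ::
    "('f, 'a, 'x) module_scheme \<Rightarrow> ('f, 'a, 'w, 'y) kv_mod_scheme
      \<Rightarrow> ('f, 'a, 'v, 'u) kv_mod_scheme \<Rightarrow> ('a \<Rightarrow> 'w \<Rightarrow> 'v) \<Rightarrow> ('w \<Rightarrow> 'a \<Rightarrow> 'v)
      \<Rightarrow> ('a \<times> 'w) list \<Rightarrow> 'v" where
  "bilinear_cochain A W V \<phi> \<psi> = (\<lambda>bs\<in>tuples (semidirect A W) (Suc (Suc 0)).
     \<phi> (fst (bs ! 0)) (snd (bs ! 1)) \<oplus>\<^bsub>V\<^esub> \<psi> (snd (bs ! 0)) (fst (bs ! 1)))"

lemma bilinear_cochain_apply:
  assumes "a \<in> carrier A" "w \<in> carrier W" "a' \<in> carrier A" "w' \<in> carrier W"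
  shows "bilinear_cochain A W V \<phi> \<psi> [(a, w), (a', w')] = \<phi> a w' \<oplus>\<^bsub>V\<^esub> \<psi> w a'"
  using assms by (simp add: bilinear_cochain_def tuples_iff)

definition linear_cochain ::
    "('f, 'a, 'x) module_scheme \<Rightarrow> ('f, 'a, 'w, 'y) kv_mod_scheme \<Rightarrow> ('w \<Rightarrow> 'v)
      \<Rightarrow> ('a \<times> 'w) list \<Rightarrow> 'v" where
  "linear_cochain A W \<theta> = (\<lambda>bs\<in>tuples (semidirect A W) (Suc 0). \<theta> (snd (bs ! 0)))"

lemma linear_cochain_apply:
  "a \<in> carrier A \<Longrightarrow> w \<in> carrier W \<Longrightarrow> linear_cochain A W \<theta> [(a, w)] = \<theta> w"
  by (simp add: linear_cochain_def tuples_iff)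

text \<open>The homogeneity condition quantifies over the set of positions occupied by arguments from \<open>W\<close>. With
one or two positions, the sets with a number of elements different from one are the empty and the
full set.\<close>

lemma subset_one_card_cases:
  "(\<forall>S\<subseteq>{..<Suc 0}. P S \<longrightarrow> card S \<noteq> Suc 0 \<longrightarrow> Q) \<longleftrightarrow> (P {} \<longrightarrow> Q)"
proof -
  have "{..<Suc 0} = {0}" by auto
  then show ?thesis by (auto simp: subset_singleton_iff)
qed

lemma subset_two_card_cases:
  "(\<forall>S\<subseteq>{..<Suc (Suc 0)}. P S \<longrightarrow> card S \<noteq> Suc 0 \<longrightarrow> Q) \<longleftrightarrow> (P {} \<longrightarrow> Q) \<and> (P {0, 1} \<longrightarrow> Q)"
proof -
  have eq: "{..<Suc (Suc 0)} = {0, 1}" by auto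
  have "card S \<noteq> Suc 0 \<longleftrightarrow> S = {} \<or> S = {0, 1}" if "S \<subseteq> {0, 1}" for S :: "nat set"
  proof -
    have "S \<in> Pow {0, 1}" using that by blast
    then have "S = {} \<or> S = {0} \<or> S = {1} \<or> S = {0, 1}" by (simp add: Pow_insert) blast
    then show ?thesis by (elim disjE) simp_all
  qed
  then show ?thesis unfolding eq by blast
qed

lemma bicochains_1_0_iff:
  "f \<in> carrier (bicochains F A W V 1 0) \<longleftrightarrow>
     f \<in> tuples (semidirect A W) (Suc 0) \<rightarrow>\<^sub>E carrier V \<and>
     (\<lambda>x. f [x]) \<in> linear_maps F (semidirect A W) V \<and>
     (\<zero>\<^bsub>W\<^esub> \<in> carrier W \<longrightarrow> (\<forall>a\<in>carrier A. f [(a, \<zero>\<^bsub>W\<^esub>)] = \<zero>\<^bsub>V\<^esub>))"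
  unfolding bicochains_def Let_def
  by (auto simp: cochains_def multilinear_maps_1_iff subset_one_card_cases ball_tuples)

lemma bicochains_1_1_iff:
  "f \<in> carrier (bicochains F A W V 1 1) \<longleftrightarrow>
     f \<in> tuples (semidirect A W) (Suc (Suc 0)) \<rightarrow>\<^sub>E carrier V \<and>
     (\<lambda>x y. f [x, y]) \<in> bilinear_maps F (semidirect A W) (semidirect A W) V \<and>
     (\<zero>\<^bsub>W\<^esub> \<in> carrier W \<longrightarrow>
       (\<forall>a\<in>carrier A. \<forall>b\<in>carrier A. f [(a, \<zero>\<^bsub>W\<^esub>), (b, \<zero>\<^bsub>W\<^esub>)] = \<zero>\<^bsub>V\<^esub>)) \<and>
     (\<zero>\<^bsub>A\<^esub> \<in> carrier A \<longrightarrow>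
       (\<forall>v\<in>carrier W. \<forall>w\<in>carrier W. f [(\<zero>\<^bsub>A\<^esub>, v), (\<zero>\<^bsub>A\<^esub>, w)] = \<zero>\<^bsub>V\<^esub>))"
  unfolding bicochains_def Let_def
  by (auto simp: cochains_def multilinear_maps_2_iff subset_two_card_cases ball_tuples
      less_Suc_eq all_conj_distrib)

context kv_module_pair
begin

text \<open>By additivity, \<open>f(a, w) = f(a, 0) + f(0, w)\<close>, and homogeneity removes the first term.\<close>

lemma bicochains_1_0:
  "carrier (bicochains F A W V 1 0) = linear_cochain A W ` linear_maps F W V"
proof (intro equalityI subsetI)
  let ?B = "semidirect A W"
  fix f assume f: "f \<in> carrier (bicochains F A W V 1 0)"
  then have ext: "f \<in> tuples ?B (Suc 0) \<rightarrow>\<^sub>E carrier V"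
    and lin: "(\<lambda>x. f [x]) \<in> linear_maps F ?B V"
    and zero: "\<And>a. a \<in> carrier A \<Longrightarrow> f [(a, \<zero>\<^bsub>W\<^esub>)] = \<zero>\<^bsub>V\<^esub>"
    unfolding bicochains_1_0_iff by simp_all
  define \<theta> where "\<theta> w = f [(\<zero>\<^bsub>A\<^esub>, w)]" for w
  have add: "f [x \<oplus>\<^bsub>?B\<^esub> y] = f [x] \<oplus>\<^bsub>V\<^esub> f [y]" if "x \<in> carrier ?B" "y \<in> carrier ?B" for x y
    using lin that unfolding linear_maps_iff by blast
  have smult: "f [c \<odot>\<^bsub>?B\<^esub> x] = c \<odot>\<^bsub>V\<^esub> f [x]" if "c \<in> carrier F" "x \<in> carrier ?B" for c x
    using lin that unfolding linear_maps_iff by blast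
  have \<theta>_closed: "\<theta> w \<in> carrier V" if "w \<in> carrier W" for w
    using lin that by (simp add: linear_maps_iff \<theta>_def)
  have "\<theta> \<in> linear_maps F W V"
    unfolding linear_maps_iff
  proof (intro conjI ballI)
    fix v w assume "v \<in> carrier W" "w \<in> carrier W"
    then show "\<theta> (v \<oplus>\<^bsub>W\<^esub> w) = \<theta> v \<oplus>\<^bsub>V\<^esub> \<theta> w"
      using add[of "(\<zero>\<^bsub>A\<^esub>, v)" "(\<zero>\<^bsub>A\<^esub>, w)"] by (simp add: \<theta>_def)
  next
    fix c w assume "c \<in> carrier F" "w \<in> carrier W"
    then show "\<theta> (c \<odot>\<^bsub>W\<^esub> w) = c \<odot>\<^bsub>V\<^esub> \<theta> w"
      using smult[of c "(\<zero>\<^bsub>A\<^esub>, w)"] by (simp add: \<theta>_def)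
  qed (rule \<theta>_closed)
  moreover have "f = linear_cochain A W \<theta>"
  proof (rule extensionalityI)
    show "f \<in> extensional (tuples ?B (Suc 0))" using ext by (simp add: PiE_def)
    fix bs assume "bs \<in> tuples ?B (Suc 0)"
    then obtain a w where "a \<in> carrier A" "w \<in> carrier W" "bs = [(a, w)]"
      by (auto simp: tuples_iff)
    then show "f bs = linear_cochain A W \<theta> bs"
      using add[of "(a, \<zero>\<^bsub>W\<^esub>)" "(\<zero>\<^bsub>A\<^esub>, w)"] zero \<theta>_closed[of w]
      by (simp add: linear_cochain_apply \<theta>_def)
  qed (simp add: linear_cochain_def)
  ultimately show "f \<in> linear_cochain A W ` linear_maps F W V" by blast
next
  fix f assume "f \<in> linear_cochain A W ` linear_maps F W V"
  then obtain \<theta> where \<theta>: "\<theta> \<in> linear_maps F W V" and f: "f = linear_cochain A W \<theta>" by blast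
  have "\<theta> \<zero>\<^bsub>W\<^esub> = \<zero>\<^bsub>V\<^esub>" by (rule linear_maps_zero[OF W_module V_module \<theta>])
  then show "f \<in> carrier (bicochains F A W V 1 0)"
    using \<theta> unfolding bicochains_1_0_iff f
    by (auto simp: linear_maps_iff linear_cochain_apply linear_cochain_def tuples_iff)
qed

lemma bilinear_cochain_in_bicochains:
  assumes \<phi>: "\<phi> \<in> bilinear_maps F A W V" and \<psi>: "\<psi> \<in> bilinear_maps F W A V"
  shows "bilinear_cochain A W V \<phi> \<psi> \<in> carrier (bicochains F A W V 1 1)"
proof -
  note lin = bilinear_mapsD[OF \<phi>] bilinear_mapsD[OF \<psi>]
    bilinear_maps_zero[OF A_module W_module V_module \<phi>]
    bilinear_maps_zero[OF W_module A_module V_module \<psi>]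
  have "(\<lambda>x y. bilinear_cochain A W V \<phi> \<psi> [x, y]) \<in>
      bilinear_maps F (semidirect A W) (semidirect A W) V"
    unfolding bilinear_maps_iff
    by (auto simp: bilinear_cochain_apply lin V.W.M.a_ac V.W.smult_r_distr)
  then show ?thesis
    unfolding bicochains_1_1_iff
    by (auto simp: bilinear_cochain_apply lin) (auto simp: bilinear_cochain_def lin tuples_iff)
qed

text \<open>Biadditivity expands \<open>f((a, w), (a', w'))\<close> into four terms, of which homogeneity removes the one with
both arguments from \<open>A\<close> and the one with both arguments from \<open>W\<close>.\<close>

lemma bicochains_1_1E:
  assumes f: "f \<in> carrier (bicochains F A W V 1 1)"
  obtains \<phi> \<psi> where "\<phi> \<in> bilinear_maps F A W V" "\<psi> \<in> bilinear_maps F W A V"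
    "f = bilinear_cochain A W V \<phi> \<psi>"
proof -
  let ?B = "semidirect A W"
  have ext: "f \<in> tuples ?B (Suc (Suc 0)) \<rightarrow>\<^sub>E carrier V"
    and bil: "(\<lambda>x y. f [x, y]) \<in> bilinear_maps F ?B ?B V"
    and zeroA: "\<And>a b. \<lbrakk>a \<in> carrier A; b \<in> carrier A\<rbrakk> \<Longrightarrow> f [(a, \<zero>\<^bsub>W\<^esub>), (b, \<zero>\<^bsub>W\<^esub>)] = \<zero>\<^bsub>V\<^esub>"
    and zeroW: "\<And>v w. \<lbrakk>v \<in> carrier W; w \<in> carrier W\<rbrakk> \<Longrightarrow> f [(\<zero>\<^bsub>A\<^esub>, v), (\<zero>\<^bsub>A\<^esub>, w)] = \<zero>\<^bsub>V\<^esub>"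
    using f unfolding bicochains_1_1_iff by simp_all
  note f_lin = bilinear_mapsD[OF bil]
  define \<phi> where "\<phi> a w = f [(a, \<zero>\<^bsub>W\<^esub>), (\<zero>\<^bsub>A\<^esub>, w)]" for a w
  define \<psi> where "\<psi> w a = f [(\<zero>\<^bsub>A\<^esub>, w), (a, \<zero>\<^bsub>W\<^esub>)]" for a w
  have closed: "\<phi> a w \<in> carrier V" "\<psi> w a \<in> carrier V" if "a \<in> carrier A" "w \<in> carrier W" for a w
    using f_lin(1) that by (simp_all add: \<phi>_def \<psi>_def)
  have \<phi>: "\<phi> \<in> bilinear_maps F A W V"
    unfolding bilinear_maps_iff
  proof (intro conjI ballI)
    fix a w w' assume "a \<in> carrier A" "w \<in> carrier W" "w' \<in> carrier W"
    then show "\<phi> a (w \<oplus>\<^bsub>W\<^esub> w') = \<phi> a w \<oplus>\<^bsub>V\<^esub> \<phi> a w'"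
      using f_lin(2)[of "(a, \<zero>\<^bsub>W\<^esub>)" "(\<zero>\<^bsub>A\<^esub>, w)" "(\<zero>\<^bsub>A\<^esub>, w')"] by (simp add: \<phi>_def)
  next
    fix a a' w assume "a \<in> carrier A" "a' \<in> carrier A" "w \<in> carrier W"
    then show "\<phi> (a \<oplus>\<^bsub>A\<^esub> a') w = \<phi> a w \<oplus>\<^bsub>V\<^esub> \<phi> a' w"
      using f_lin(3)[of "(a, \<zero>\<^bsub>W\<^esub>)" "(a', \<zero>\<^bsub>W\<^esub>)" "(\<zero>\<^bsub>A\<^esub>, w)"] by (simp add: \<phi>_def)
  next
    fix c a w assume "c \<in> carrier F" "a \<in> carrier A" "w \<in> carrier W"
    then show "\<phi> a (c \<odot>\<^bsub>W\<^esub> w) = c \<odot>\<^bsub>V\<^esub> \<phi> a w" "\<phi> (c \<odot>\<^bsub>A\<^esub> a) w = c \<odot>\<^bsub>V\<^esub> \<phi> a w"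
      using f_lin(4,5)[of c "(a, \<zero>\<^bsub>W\<^esub>)" "(\<zero>\<^bsub>A\<^esub>, w)"] by (simp_all add: \<phi>_def)
  qed (use closed in simp)
  have \<psi>: "\<psi> \<in> bilinear_maps F W A V"
    unfolding bilinear_maps_iff
  proof (intro conjI ballI)
    fix a w w' assume "w \<in> carrier W" "w' \<in> carrier W" "a \<in> carrier A"
    then show "\<psi> (w \<oplus>\<^bsub>W\<^esub> w') a = \<psi> w a \<oplus>\<^bsub>V\<^esub> \<psi> w' a"
      using f_lin(3)[of "(\<zero>\<^bsub>A\<^esub>, w)" "(\<zero>\<^bsub>A\<^esub>, w')" "(a, \<zero>\<^bsub>W\<^esub>)"] by (simp add: \<psi>_def)
  next
    fix a a' w assume "w \<in> carrier W" "a \<in> carrier A" "a' \<in> carrier A"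
    then show "\<psi> w (a \<oplus>\<^bsub>A\<^esub> a') = \<psi> w a \<oplus>\<^bsub>V\<^esub> \<psi> w a'"
      using f_lin(2)[of "(\<zero>\<^bsub>A\<^esub>, w)" "(a, \<zero>\<^bsub>W\<^esub>)" "(a', \<zero>\<^bsub>W\<^esub>)"] by (simp add: \<psi>_def)
  next
    fix c a w assume "c \<in> carrier F" "w \<in> carrier W" "a \<in> carrier A"
    then show "\<psi> w (c \<odot>\<^bsub>A\<^esub> a) = c \<odot>\<^bsub>V\<^esub> \<psi> w a" "\<psi> (c \<odot>\<^bsub>W\<^esub> w) a = c \<odot>\<^bsub>V\<^esub> \<psi> w a"
      using f_lin(4,5)[of c "(\<zero>\<^bsub>A\<^esub>, w)" "(a, \<zero>\<^bsub>W\<^esub>)"] by (simp_all add: \<psi>_def)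
  qed (use closed in simp)
  have "f = bilinear_cochain A W V \<phi> \<psi>"
  proof (rule extensionalityI)
    show "f \<in> extensional (tuples ?B (Suc (Suc 0)))" using ext by (simp add: PiE_def)
    fix bs assume "bs \<in> tuples ?B (Suc (Suc 0))"
    then obtain a w a' w' where *: "a \<in> carrier A" "w \<in> carrier W" "a' \<in> carrier A" "w' \<in> carrier W"
      and bs: "bs = [(a, w), (a', w')]"
      by (auto simp: tuples_iff)
    have r: "f [x, (a', w')] = f [x, (a', \<zero>\<^bsub>W\<^esub>)] \<oplus>\<^bsub>V\<^esub> f [x, (\<zero>\<^bsub>A\<^esub>, w')]" if "x \<in> carrier ?B" for x
      using f_lin(2)[OF that, of "(a', \<zero>\<^bsub>W\<^esub>)" "(\<zero>\<^bsub>A\<^esub>, w')"] * by simp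
    have "f bs = f [(a, \<zero>\<^bsub>W\<^esub>), (a', w')] \<oplus>\<^bsub>V\<^esub> f [(\<zero>\<^bsub>A\<^esub>, w), (a', w')]"
      using f_lin(3)[of "(a, \<zero>\<^bsub>W\<^esub>)" "(\<zero>\<^bsub>A\<^esub>, w)" "(a', w')"] * by (simp add: bs)
    also have "\<dots> = \<phi> a w' \<oplus>\<^bsub>V\<^esub> \<psi> w a'"
      using * closed by (simp add: r zeroA zeroW flip: \<phi>_def \<psi>_def)
    finally show "f bs = bilinear_cochain A W V \<phi> \<psi> bs"
      using * by (simp add: bs bilinear_cochain_apply)
  qed (simp add: bilinear_cochain_def)
  with \<phi> \<psi> show ?thesis by (rule that)
qed

section \<open>The differential on cochains of bidegree \<open>(1,0)\<close> and \<open>(1,1)\<close>\<close>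

lemma coboundary_1_apply:
  assumes closed: "\<And>x. x \<in> carrier (semidirect A W) \<Longrightarrow> f [x] \<in> carrier V"
    and "a \<in> carrier A" "v \<in> carrier W" "b \<in> carrier A" "w \<in> carrier W"
  shows "bicoboundary F A W V 1 f [(a, v), (b, w)] =
    \<ominus>\<^bsub>V\<^esub> (lact V a (f [(b, w)]) \<ominus>\<^bsub>V\<^esub> f [(a \<otimes>\<^bsub>A\<^esub> b, lact W a w \<oplus>\<^bsub>W\<^esub> ract W v b)]
        \<oplus>\<^bsub>V\<^esub> ract V (f [(a, v)]) b)"
proof -
  interpret I: module F "inflate V :: ('f, 'a \<times> 'w, 'v) kv_mod" by (rule inflate_module[OF V_module])
  have eq: "{..<Suc 0} = {0}" by auto
  show ?thesis
    using assms
    by (simp add: coboundary_def tuples_iff cochain_act_def omit_nth_def eq V.W.smult_l_minus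
        I.M.finsum_insert)
qed

lemma coboundary_2_apply:
  assumes closed: "\<And>x y. \<lbrakk>x \<in> carrier (semidirect A W); y \<in> carrier (semidirect A W)\<rbrakk>
      \<Longrightarrow> f [x, y] \<in> carrier V"
    and "a \<in> carrier A" "u \<in> carrier W" "b \<in> carrier A" "v \<in> carrier W" "c \<in> carrier A" "w \<in> carrier W"
    and x: "x = (a, u)" and y: "y = (b, v)" and z: "z = (c, w)"
  shows "bicoboundary F A W V 2 f [x, y, z] =
    \<ominus>\<^bsub>V\<^esub> ((lact V a (f [y, z]) \<ominus>\<^bsub>V\<^esub>
            (f [x \<otimes>\<^bsub>semidirect A W\<^esub> y, z] \<oplus>\<^bsub>V\<^esub> f [y, x \<otimes>\<^bsub>semidirect A W\<^esub> z]))
          \<oplus>\<^bsub>V\<^esub> ract V (f [y, x]) c) \<oplus>\<^bsub>V\<^esub>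
    ((lact V b (f [x, z]) \<ominus>\<^bsub>V\<^esub>
            (f [y \<otimes>\<^bsub>semidirect A W\<^esub> x, z] \<oplus>\<^bsub>V\<^esub> f [x, y \<otimes>\<^bsub>semidirect A W\<^esub> z]))
          \<oplus>\<^bsub>V\<^esub> ract V (f [x, y]) c)"
proof -
  interpret I: module F "inflate V :: ('f, 'a \<times> 'w, 'v) kv_mod" by (rule inflate_module[OF V_module])
  have eq: "{..<Suc (Suc 0)} = {0, Suc 0}" by auto
  have sign: "\<ominus>\<^bsub>F\<^esub> \<one>\<^bsub>F\<^esub> \<otimes>\<^bsub>F\<^esub> \<ominus>\<^bsub>F\<^esub> \<one>\<^bsub>F\<^esub> = \<one>\<^bsub>F\<^esub>"
    by (simp add: W.l_minus)
  have num: "2 = Suc (Suc 0)" by simp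
  show ?thesis
    using assms
    by (simp add: coboundary_def tuples_iff cochain_act_def omit_nth_def num eq sign V.W.smult_l_minus
        I.M.finsum_insert)
qed

text \<open>\<open>\<delta> f\<close> is a difference of two expressions that are exchanged by swapping the first two arguments; its
vanishing is stated without negative terms, so that it can be compared with the cocycle equations by
sorting summands.\<close>

lemma coboundary_2_eq_zero_iff:
  assumes \<phi>: "\<phi> \<in> bilinear_maps F A W V" and \<psi>: "\<psi> \<in> bilinear_maps F W A V"
    and *: "a \<in> carrier A" "u \<in> carrier W" "b \<in> carrier A" "v \<in> carrier W" "c \<in> carrier A" "w \<in> carrier W"
  shows "bicoboundary F A W V 2 (bilinear_cochain A W V \<phi> \<psi>) [(a, u), (b, v), (c, w)] = \<zero>\<^bsub>V\<^esub> \<longleftrightarrow>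
    (lact V a (\<phi> b w) \<oplus>\<^bsub>V\<^esub> lact V a (\<psi> v c)) \<oplus>\<^bsub>V\<^esub> (ract V (\<phi> b u) c \<oplus>\<^bsub>V\<^esub> ract V (\<psi> v a) c) \<oplus>\<^bsub>V\<^esub>
      (\<phi> (b \<otimes>\<^bsub>A\<^esub> a) w \<oplus>\<^bsub>V\<^esub> (\<psi> (lact W b u) c \<oplus>\<^bsub>V\<^esub> \<psi> (ract W v a) c) \<oplus>\<^bsub>V\<^esub>
       ((\<phi> a (lact W b w) \<oplus>\<^bsub>V\<^esub> \<phi> a (ract W v c)) \<oplus>\<^bsub>V\<^esub> \<psi> u (b \<otimes>\<^bsub>A\<^esub> c))) =
    (lact V b (\<phi> a w) \<oplus>\<^bsub>V\<^esub> lact V b (\<psi> u c)) \<oplus>\<^bsub>V\<^esub> (ract V (\<phi> a v) c \<oplus>\<^bsub>V\<^esub> ract V (\<psi> u b) c) \<oplus>\<^bsub>V\<^esub>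
      (\<phi> (a \<otimes>\<^bsub>A\<^esub> b) w \<oplus>\<^bsub>V\<^esub> (\<psi> (lact W a v) c \<oplus>\<^bsub>V\<^esub> \<psi> (ract W u b) c) \<oplus>\<^bsub>V\<^esub>
       ((\<phi> b (lact W a w) \<oplus>\<^bsub>V\<^esub> \<phi> b (ract W u c)) \<oplus>\<^bsub>V\<^esub> \<psi> v (a \<otimes>\<^bsub>A\<^esub> c)))"
proof -
  note lin = bilinear_mapsD[OF \<phi>] bilinear_mapsD[OF \<psi>]
  \<comment> \<open>\<open>l\<close>, \<open>r\<close>: the outer actions of a \<open>b\<^sub>j\<close> and of the last argument; \<open>s\<close>: the terms with a product inside \<open>f\<close>\<close>
  have neg: "\<ominus>\<^bsub>V\<^esub> ((l1 \<ominus>\<^bsub>V\<^esub> s1) \<oplus>\<^bsub>V\<^esub> r1) \<oplus>\<^bsub>V\<^esub> ((l2 \<ominus>\<^bsub>V\<^esub> s2) \<oplus>\<^bsub>V\<^esub> r2) = \<zero>\<^bsub>V\<^esub> \<longleftrightarrow>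
      l1 \<oplus>\<^bsub>V\<^esub> r1 \<oplus>\<^bsub>V\<^esub> s2 = l2 \<oplus>\<^bsub>V\<^esub> r2 \<oplus>\<^bsub>V\<^esub> s1"
    if "l1 \<in> carrier V" "s1 \<in> carrier V" "r1 \<in> carrier V"
      "l2 \<in> carrier V" "s2 \<in> carrier V" "r2 \<in> carrier V" for l1 s1 r1 l2 s2 r2
  proof -
    have move: "(l \<ominus>\<^bsub>V\<^esub> s) \<oplus>\<^bsub>V\<^esub> r = (l \<oplus>\<^bsub>V\<^esub> r) \<ominus>\<^bsub>V\<^esub> s"
      if "l \<in> carrier V" "s \<in> carrier V" "r \<in> carrier V" for l s r
      using that by (simp add: a_minus_def V.W.M.a_ac)
    have "\<ominus>\<^bsub>V\<^esub> x \<oplus>\<^bsub>V\<^esub> y = \<zero>\<^bsub>V\<^esub> \<longleftrightarrow> x = y" if "x \<in> carrier V" "y \<in> carrier V" for x y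
      using that by (metis V.W.M.a_inv_closed V.W.M.l_neg V.W.M.minus_equality V.W.M.minus_minus V.W.M.a_comm)
    then show ?thesis using that by (simp add: move V.W.M.minus_eq_minus_iff)
  qed
  have closed: "bilinear_cochain A W V \<phi> \<psi> [x, y] \<in> carrier V"
    if "x \<in> carrier (semidirect A W)" "y \<in> carrier (semidirect A W)" for x y
    using that by (auto simp: bilinear_cochain_apply lin)
  show ?thesis
    apply (subst coboundary_2_apply[where f = "bilinear_cochain A W V \<phi> \<psi>", OF closed * refl refl refl])
    apply assumption+
    using * apply (simp_all add: bilinear_cochain_apply lin)
    apply (subst neg)
    using * apply (simp_all add: lin act_linear)
    done
qed

text \<open>The cocycle equations are the vanishing of \<open>\<delta> f\<close> at \<open>((a, 0), (b, 0), (0, w))\<close> and at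
\<open>((a, 0), (0, w), (b, 0))\<close>. Conversely, the vanishing at \<open>((a, u), (b, v), (c, w))\<close> is the sum of the
first equation for \<open>(a, b, w)\<close>, the second for \<open>(a, v, c)\<close>, and the second for \<open>(b, u, c)\<close> with its
sides exchanged.\<close>

lemma coboundary_cocycle_iff:
  assumes \<phi>: "\<phi> \<in> bilinear_maps F A W V" and \<psi>: "\<psi> \<in> bilinear_maps F W A V"
  shows "bicoboundary F A W V 2 (bilinear_cochain A W V \<phi> \<psi>) = \<zero>\<^bsub>bicochains F A W V 1 2\<^esub> \<longleftrightarrow>
    extension_cocycle F A W V \<phi> \<psi>"
proof -
  let ?B = "semidirect A W" and ?f = "bilinear_cochain A W V \<phi> \<psi>"
  note lin = bilinear_mapsD[OF \<phi>] bilinear_mapsD[OF \<psi>]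
    bilinear_maps_zero[OF A_module W_module V_module \<phi>]
    bilinear_maps_zero[OF W_module A_module V_module \<psi>]
  have num: "2 = Suc (Suc 0)" "1 + Suc (Suc 0) = Suc (Suc (Suc 0))" by simp_all
  have pointwise: "bicoboundary F A W V 2 ?f = \<zero>\<^bsub>bicochains F A W V 1 2\<^esub> \<longleftrightarrow>
      (\<forall>x\<in>carrier ?B. \<forall>y\<in>carrier ?B. \<forall>z\<in>carrier ?B. bicoboundary F A W V 2 ?f [x, y, z] = \<zero>\<^bsub>V\<^esub>)"
  proof -
    have zero: "\<zero>\<^bsub>bicochains F A W V 1 2\<^esub> = (\<lambda>bs\<in>tuples ?B (Suc (Suc (Suc 0))). \<zero>\<^bsub>V\<^esub>)"
      by (simp add: bicochains_def cochains_def num)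
    have const: "g = (\<lambda>bs\<in>S. z) \<longleftrightarrow> (\<forall>bs\<in>S. g bs = z)" if "g \<in> extensional S" for g :: "'b \<Rightarrow> 'c" and S z
      using that by (auto intro: extensionalityI)
    have ext: "bicoboundary F A W V 2 ?f \<in> extensional (tuples ?B (Suc (Suc (Suc 0))))"
      by (simp add: coboundary_def num)
    show ?thesis unfolding zero const[OF ext] ball_tuples ..
  qed
  show ?thesis
  proof
    assume "bicoboundary F A W V 2 ?f = \<zero>\<^bsub>bicochains F A W V 1 2\<^esub>"
    then have *: "bicoboundary F A W V 2 ?f [(a, u), (b, v), (c, w)] = \<zero>\<^bsub>V\<^esub>"
      if "a \<in> carrier A" "u \<in> carrier W" "b \<in> carrier A" "v \<in> carrier W" "c \<in> carrier A" "w \<in> carrier W"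
      for a u b v c w
      using that unfolding pointwise by simp
    show "extension_cocycle F A W V \<phi> \<psi>"
      unfolding extension_cocycle_def
    proof (intro conjI ballI)
      fix a b w assume abw: "a \<in> carrier A" "b \<in> carrier A" "w \<in> carrier W"
      show "\<phi> (a \<otimes>\<^bsub>A\<^esub> b) w \<oplus>\<^bsub>V\<^esub> (lact V b (\<phi> a w) \<oplus>\<^bsub>V\<^esub> \<phi> b (lact W a w)) =
          \<phi> (b \<otimes>\<^bsub>A\<^esub> a) w \<oplus>\<^bsub>V\<^esub> (lact V a (\<phi> b w) \<oplus>\<^bsub>V\<^esub> \<phi> a (lact W b w))"
        using *[of a "\<zero>\<^bsub>W\<^esub>" b "\<zero>\<^bsub>W\<^esub>" "\<zero>\<^bsub>A\<^esub>" w] abw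
        by (simp add: coboundary_2_eq_zero_iff[OF \<phi> \<psi>] lin act_linear V.W.M.a_ac)
    next
      fix a b w assume abw: "a \<in> carrier A" "b \<in> carrier A" "w \<in> carrier W"
      show "ract V (\<phi> a w) b \<oplus>\<^bsub>V\<^esub> \<psi> (lact W a w) b \<oplus>\<^bsub>V\<^esub> \<psi> w (a \<otimes>\<^bsub>A\<^esub> b) =
          ract V (\<psi> w a) b \<oplus>\<^bsub>V\<^esub> \<psi> (ract W w a) b \<oplus>\<^bsub>V\<^esub>
            (lact V a (\<psi> w b) \<oplus>\<^bsub>V\<^esub> \<phi> a (ract W w b))"
        using *[of a "\<zero>\<^bsub>W\<^esub>" "\<zero>\<^bsub>A\<^esub>" w b "\<zero>\<^bsub>W\<^esub>"] abw
        by (simp add: coboundary_2_eq_zero_iff[OF \<phi> \<psi>] lin act_linear V.W.M.a_ac)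
    qed (use \<phi> \<psi> in simp_all)
  next
    assume coc: "extension_cocycle F A W V \<phi> \<psi>"
    have abw: "\<phi> (a \<otimes>\<^bsub>A\<^esub> b) w \<oplus>\<^bsub>V\<^esub> (lact V b (\<phi> a w) \<oplus>\<^bsub>V\<^esub> \<phi> b (lact W a w)) =
        \<phi> (b \<otimes>\<^bsub>A\<^esub> a) w \<oplus>\<^bsub>V\<^esub> (lact V a (\<phi> b w) \<oplus>\<^bsub>V\<^esub> \<phi> a (lact W b w))"
      and awb: "(ract V (\<phi> a w) b \<oplus>\<^bsub>V\<^esub> \<psi> (lact W a w) b) \<oplus>\<^bsub>V\<^esub> \<psi> w (a \<otimes>\<^bsub>A\<^esub> b) =
        (ract V (\<psi> w a) b \<oplus>\<^bsub>V\<^esub> \<psi> (ract W w a) b) \<oplus>\<^bsub>V\<^esub>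
          (lact V a (\<psi> w b) \<oplus>\<^bsub>V\<^esub> \<phi> a (ract W w b))"
      if "a \<in> carrier A" "b \<in> carrier A" "w \<in> carrier W" for a b w
      using coc that unfolding extension_cocycle_def by blast+
    have "bicoboundary F A W V 2 ?f [(a, u), (b, v), (c, w)] = \<zero>\<^bsub>V\<^esub>"
      if *: "a \<in> carrier A" "u \<in> carrier W" "b \<in> carrier A" "v \<in> carrier W" "c \<in> carrier A" "w \<in> carrier W"
      for a u b v c w
    proof -
      \<comment> \<open>the three cocycle equations are added and the summands sorted\<close>
      have add: "p1 \<oplus>\<^bsub>V\<^esub> p2 \<oplus>\<^bsub>V\<^esub> p3 = q1 \<oplus>\<^bsub>V\<^esub> q2 \<oplus>\<^bsub>V\<^esub> q3"
        if "p1 = q1" "p2 = q2" "p3 = q3" for p1 p2 p3 q1 q2 q3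
        using that by simp
      show ?thesis
        unfolding coboundary_2_eq_zero_iff[OF \<phi> \<psi> *]
        using add[OF abw[of a b w] awb[of a c v] awb[of b c u, symmetric]] *
        by (simp add: lin V.W.M.a_ac)
    qed
    then show "bicoboundary F A W V 2 ?f = \<zero>\<^bsub>bicochains F A W V 1 2\<^esub>"
      unfolding pointwise by auto
  qed
qed

lemma kernel_eq:
  "a_kernel (bicochains F A W V 1 1) (bicochains F A W V 1 2) (bicoboundary F A W V 2) =
    {bilinear_cochain A W V \<phi> \<psi> |\<phi> \<psi>. extension_cocycle F A W V \<phi> \<psi>}"
proof -
  have "extension_cocycle F A W V \<phi> \<psi> \<Longrightarrow> \<phi> \<in> bilinear_maps F A W V \<and> \<psi> \<in> bilinear_maps F W A V" for \<phi> \<psi>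
    by (simp add: extension_cocycle_def)
  then show ?thesis
    unfolding a_kernel_def'
    by (auto simp: coboundary_cocycle_iff bilinear_cochain_in_bicochains elim!: bicochains_1_1E simp del: One_nat_def)
      blast
qed

lemma coboundary_linear_cochain:
  assumes \<theta>: "\<theta> \<in> linear_maps F W V"
  shows "bicoboundary F A W V 1 (linear_cochain A W \<theta>) =
    bilinear_cochain A W V (\<lambda>a w. \<theta> (lact W a w) \<ominus>\<^bsub>V\<^esub> lact V a (\<theta> w))
      (\<lambda>w a. \<theta> (ract W w a) \<ominus>\<^bsub>V\<^esub> ract V (\<theta> w) a)"
proof (rule extensionalityI)
  let ?B = "semidirect A W"
  have \<theta>_closed: "\<And>w. w \<in> carrier W \<Longrightarrow> \<theta> w \<in> carrier V"
    and \<theta>_add: "\<And>v w. \<lbrakk>v \<in> carrier W; w \<in> carrier W\<rbrakk> \<Longrightarrow> \<theta> (v \<oplus>\<^bsub>W\<^esub> w) = \<theta> v \<oplus>\<^bsub>V\<^esub> \<theta> w"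
    using \<theta> by (simp_all add: linear_maps_iff)
  show "bicoboundary F A W V 1 (linear_cochain A W \<theta>) \<in> extensional (tuples ?B (Suc (Suc 0)))"
    by (simp add: coboundary_def)
  fix bs assume "bs \<in> tuples ?B (Suc (Suc 0))"
  then obtain a v b w where *: "a \<in> carrier A" "v \<in> carrier W" "b \<in> carrier A" "w \<in> carrier W"
    and bs: "bs = [(a, v), (b, w)]"
    by (auto simp: tuples_iff)
  have "bicoboundary F A W V 1 (linear_cochain A W \<theta>) bs = \<ominus>\<^bsub>V\<^esub>
      (lact V a (\<theta> w) \<ominus>\<^bsub>V\<^esub> (\<theta> (lact W a w) \<oplus>\<^bsub>V\<^esub> \<theta> (ract W v b)) \<oplus>\<^bsub>V\<^esub> ract V (\<theta> v) b)"
    unfolding bs using *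
    by (subst coboundary_1_apply) (auto simp: linear_cochain_apply \<theta>_closed \<theta>_add)
  also have "\<dots> = (\<theta> (lact W a w) \<ominus>\<^bsub>V\<^esub> lact V a (\<theta> w)) \<oplus>\<^bsub>V\<^esub> (\<theta> (ract W v b) \<ominus>\<^bsub>V\<^esub> ract V (\<theta> v) b)"
    using * by (simp add: \<theta>_closed a_minus_def V.W.M.minus_add V.W.M.a_ac)
  finally show "bicoboundary F A W V 1 (linear_cochain A W \<theta>) bs =
    bilinear_cochain A W V (\<lambda>a w. \<theta> (lact W a w) \<ominus>\<^bsub>V\<^esub> lact V a (\<theta> w))
      (\<lambda>w a. \<theta> (ract W w a) \<ominus>\<^bsub>V\<^esub> ract V (\<theta> w) a) bs"
    using * by (simp add: bs bilinear_cochain_apply)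
qed (simp add: bilinear_cochain_def)

end

section \<open>Isomorphisms of sequences\<close>

lemma kv_hom_iff:
  "h \<in> kv_hom F A M N \<longleftrightarrow>
    (\<forall>x\<in>carrier M. h x \<in> carrier N) \<and>
    (\<forall>x\<in>carrier M. \<forall>y\<in>carrier M. h (x \<oplus>\<^bsub>M\<^esub> y) = h x \<oplus>\<^bsub>N\<^esub> h y) \<and>
    (\<forall>c\<in>carrier F. \<forall>x\<in>carrier M. h (c \<odot>\<^bsub>M\<^esub> x) = c \<odot>\<^bsub>N\<^esub> h x) \<and>
    (\<forall>a\<in>carrier A. \<forall>x\<in>carrier M. h (lact M a x) = lact N a (h x)) \<and>
    (\<forall>a\<in>carrier A. \<forall>x\<in>carrier M. h (ract M x a) = ract N (h x) a)"
  unfolding kv_hom_def linear_maps_iff by auto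

lemma kv_homD:
  assumes "h \<in> kv_hom F A M N"
  shows "x \<in> carrier M \<Longrightarrow> h x \<in> carrier N"
    and "\<lbrakk>x \<in> carrier M; y \<in> carrier M\<rbrakk> \<Longrightarrow> h (x \<oplus>\<^bsub>M\<^esub> y) = h x \<oplus>\<^bsub>N\<^esub> h y"
    and "\<lbrakk>c \<in> carrier F; x \<in> carrier M\<rbrakk> \<Longrightarrow> h (c \<odot>\<^bsub>M\<^esub> x) = c \<odot>\<^bsub>N\<^esub> h x"
    and "\<lbrakk>a \<in> carrier A; x \<in> carrier M\<rbrakk> \<Longrightarrow> h (lact M a x) = lact N a (h x)"
    and "\<lbrakk>a \<in> carrier A; x \<in> carrier M\<rbrakk> \<Longrightarrow> h (ract M x a) = ract N (h x) a"
    and "h \<in> linear_maps F M N"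
  using assms by (simp_all add: kv_hom_iff linear_maps_iff)

lemma kv_hom_inverse:
  assumes L: "kv_module F A L" and g: "g \<in> kv_hom F A L M" and bij: "bij_betw g (carrier L) (carrier M)"
  shows "inv_into (carrier L) g \<in> kv_hom F A M L"
proof -
  interpret L: kv_module F A L by fact
  interpret L: module F L by (rule kv_moduleD(2)[OF L])
  let ?h = "inv_into (carrier L) g"
  note g' = kv_homD[OF g]
  note [simp] = kv_moduleD(5,6)[OF L]
  have inv: "?h (g x) = x" if "x \<in> carrier L" for x
    using bij that by (simp add: bij_betw_inv_into_left)
  have M: "carrier M = g ` carrier L" using bij by (simp add: bij_betw_def)
  show ?thesis
    unfolding kv_hom_iff M by (auto simp: inv simp flip: g'(2-5))
qed

text \<open>The zero of \<open>M\<close> is a record component that a map compatible with the operations does not control, hence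
the hypothesis on \<open>g\<close>.\<close>

lemma kv_module_iso_image:
  assumes L: "kv_module F A L" and g: "g \<in> kv_hom F A L M"
    and bij: "bij_betw g (carrier L) (carrier M)" and zero: "g \<zero>\<^bsub>L\<^esub> = \<zero>\<^bsub>M\<^esub>"
  shows "kv_module F A M"
proof -
  interpret L: module F L by (rule kv_moduleD(2)[OF L])
  note g' = kv_homD[OF g]
  note [simp] = kv_moduleD(5,6)[OF L]
  have M: "carrier M = g ` carrier L" using bij by (simp add: bij_betw_def)
  show ?thesis
  proof (rule kv_module_transport[OF L])
    show "inv_into (carrier L) g \<in> kv_hom F A M L" by (rule kv_hom_inverse[OF L g bij])
    show "inj_on (inv_into (carrier L) g) (carrier M)"
      using bij_betw_inv_into[OF bij] by (simp add: bij_betw_def)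
    show "inv_into (carrier L) g \<zero>\<^bsub>M\<^esub> = \<zero>\<^bsub>L\<^esub>"
      using bij by (simp add: bij_betw_inv_into_left flip: zero)
    show "\<zero>\<^bsub>M\<^esub> \<in> carrier M" using g'(1)[OF L.M.zero_closed] by (simp add: zero)
  qed (auto simp: M simp flip: g'(2-5))
qed

text \<open>The middle terms may live in different types. This allows a comparison of a sequence with an
extension on pairs, as opposed to \<^const>\<open>equivalent_sequences\<close>, and makes the map explicit.\<close>

definition sequence_iso ::
    "('f, 'z) ring_scheme \<Rightarrow> ('f, 'a, 'x) module_scheme \<Rightarrow> ('f, 'a, 'v, 'u) kv_mod_scheme
      \<Rightarrow> ('s \<Rightarrow> 't) \<Rightarrow> ('f, 'a, 'v, 's, 'w) sequence \<Rightarrow> ('f, 'a, 'v, 't, 'w) sequence \<Rightarrow> bool" where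
  "sequence_iso F A V g = (\<lambda>(T, i, p) (T', i', p').
     g \<in> kv_hom F A T T' \<and> bij_betw g (carrier T) (carrier T') \<and>
     (\<forall>v\<in>carrier V. g (i v) = i' v) \<and> (\<forall>t\<in>carrier T. p' (g t) = p t))"

lemma equivalent_sequences_iff:
  "equivalent_sequences F A V s s' \<longleftrightarrow> (\<exists>g. sequence_iso F A V g s s')"
  by (auto simp: equivalent_sequences_def sequence_iso_def split_beta)

lemma sequence_iso_refl: "sequence_iso F A V (\<lambda>t. t) s s"
  by (auto simp: sequence_iso_def kv_hom_iff bij_betw_def)

lemma sequence_iso_trans:
  assumes "sequence_iso F A V g s s'" "sequence_iso F A V h s' s''"
  shows "sequence_iso F A V (h \<circ> g) s s''"
  using assms
  by (auto simp: sequence_iso_def split_beta kv_hom_iff intro: bij_betw_trans)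

text \<open>The inverse of a bijective morphism is a morphism because the operations of \<open>T\<close> do not leave its
carrier.\<close>

lemma sequence_iso_sym:
  assumes iso: "sequence_iso F A V g (T, i, p) s'" and T: "kv_module F A T"
    and i: "\<And>v. v \<in> carrier V \<Longrightarrow> i v \<in> carrier T"
  shows "sequence_iso F A V (inv_into (carrier T) g) s' (T, i, p)"
proof -
  obtain T' i' p' where s': "s' = (T', i', p')" by (cases s') auto
  have g: "g \<in> kv_hom F A T T'" and bij: "bij_betw g (carrier T) (carrier T')"
    and gi: "\<And>v. v \<in> carrier V \<Longrightarrow> i' v = g (i v)"
    and pg: "\<And>t. t \<in> carrier T \<Longrightarrow> p' (g t) = p t"
    using iso by (simp_all add: sequence_iso_def s')
  have inv: "inv_into (carrier T) g (g t) = t" if "t \<in> carrier T" for t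
    using bij that by (simp add: bij_betw_inv_into_left)
  have T': "carrier T' = g ` carrier T" using bij by (simp add: bij_betw_def)
  show ?thesis
    using kv_hom_inverse[OF T g bij] bij_betw_inv_into[OF bij]
    by (auto simp: sequence_iso_def s' gi i inv T' pg)
qed

section \<open>Splittable sequences and cocycles\<close>

definition twisted_sequence ::
    "('f, 'a, 'v, 'u) kv_mod_scheme \<Rightarrow> ('f, 'a, 'w, 'y) kv_mod_scheme
      \<Rightarrow> ('a \<Rightarrow> 'w \<Rightarrow> 'v) \<Rightarrow> ('w \<Rightarrow> 'a \<Rightarrow> 'v) \<Rightarrow> ('f, 'a, 'v, 'v \<times> 'w, 'w) sequence" where
  "twisted_sequence V W \<phi> \<psi> = (twisted_sum V W \<phi> \<psi>, \<lambda>v. (v, \<zero>\<^bsub>W\<^esub>), snd)"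

definition split_sequences ::
    "('f, 'z) ring_scheme \<Rightarrow> ('f, 'a, 'x) module_scheme \<Rightarrow> ('f, 'a, 'w, 'y) kv_mod_scheme
      \<Rightarrow> ('f, 'a, 'v, 'u) kv_mod_scheme \<Rightarrow> ('f, 'a, 'v, 't, 'w) sequence set" where
  "split_sequences F A W V = {s \<in> exact_sequences F A W V. splittable F V s}"

lemma split_sequencesD:
  assumes "(T, i, p) \<in> split_sequences F A W V"
  shows "kv_module F A T" "i \<in> kv_hom F A V T" "p \<in> kv_hom F A T W"
    "inj_on i (carrier V)" "i ` carrier V = a_kernel T W p" "p ` carrier T = carrier W"
    "\<exists>U. submodule U F T \<and> i ` carrier V \<inter> U = {\<zero>\<^bsub>T\<^esub>} \<and> i ` carrier V <+>\<^bsub>T\<^esub> U = carrier T"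
  using assms
  unfolding split_sequences_def exact_sequences_def splittable_def mem_Collect_eq prod.case
  by blast+

context kv_module_pair
begin

lemma extension_cocycle_iff_kv_module:
  "extension_cocycle F A W V \<phi> \<psi> \<longleftrightarrow>
     (\<forall>a\<in>carrier A. \<forall>w\<in>carrier W. \<phi> a w \<in> carrier V \<and> \<psi> w a \<in> carrier V) \<and>
     kv_module F A (twisted_sum V W \<phi> \<psi>)"
proof -
  have "extension_cocycle F A W V \<phi> \<psi> \<Longrightarrow>
      (\<forall>a\<in>carrier A. \<forall>w\<in>carrier W. \<phi> a w \<in> carrier V \<and> \<psi> w a \<in> carrier V)"
    unfolding extension_cocycle_def using bilinear_mapsD(1)[of \<phi>] bilinear_mapsD(1)[of \<psi>] by blast
  then show ?thesis using twisted_sum_kv_module_iff[of \<phi> \<psi>] by blast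
qed

text \<open>Exactness and the complement are carried over from \<open>V \<times> W\<close>: the kernel of \<open>p\<close> is the image of
\<open>V \<times> {0}\<close>, and the image of \<open>{0} \<times> W\<close> is a complement of it.\<close>

lemma sequence_iso_twisted_imp_split:
  assumes coc: "extension_cocycle F A W V \<phi> \<psi>" and T: "kv_module F A T"
    and iso: "sequence_iso F A V g (twisted_sequence V W \<phi> \<psi>) (T, i, p)"
  shows "(T, i, p) \<in> split_sequences F A W V"
proof -
  let ?M = "twisted_sum V W \<phi> \<psi>"
  interpret T: module F T by (rule kv_moduleD(2)[OF T])
  have \<phi>: "\<phi> \<in> bilinear_maps F A W V" and \<psi>: "\<psi> \<in> bilinear_maps F W A V"
    using coc by (simp_all add: extension_cocycle_def)
  note lin = bilinear_mapsD[OF \<phi>] bilinear_mapsD[OF \<psi>]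
    bilinear_maps_zero[OF A_module W_module V_module \<phi>]
    bilinear_maps_zero[OF W_module A_module V_module \<psi>]
  have M: "kv_module F A ?M" using coc by (simp add: extension_cocycle_iff_kv_module)
  have g: "g \<in> kv_hom F A ?M T" and bij: "bij_betw g (carrier V \<times> carrier W) (carrier T)"
    and i: "\<And>v. v \<in> carrier V \<Longrightarrow> i v = g (v, \<zero>\<^bsub>W\<^esub>)"
    and p: "\<And>v w. \<lbrakk>v \<in> carrier V; w \<in> carrier W\<rbrakk> \<Longrightarrow> p (g (v, w)) = w"
    using iso by (auto simp: sequence_iso_def twisted_sequence_def)
  note g' = kv_homD[OF g]
  have inj: "inj_on g (carrier V \<times> carrier W)" and Tg: "carrier T = g ` (carrier V \<times> carrier W)"
    using bij by (simp_all add: bij_betw_def)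
  have zero: "g (\<zero>\<^bsub>V\<^esub>, \<zero>\<^bsub>W\<^esub>) = \<zero>\<^bsub>T\<^esub>"
    using linear_maps_zero[OF kv_moduleD(2)[OF M] kv_moduleD(2)[OF T] g'(6)] by simp
  have closed: "g (v, w) \<in> carrier T" if "v \<in> carrier V" "w \<in> carrier W" for v w
    using g'(1) that by simp
  have add: "g (v, w) \<oplus>\<^bsub>T\<^esub> g (v', w') = g (v \<oplus>\<^bsub>V\<^esub> v', w \<oplus>\<^bsub>W\<^esub> w')"
    if "v \<in> carrier V" "w \<in> carrier W" "v' \<in> carrier V" "w' \<in> carrier W" for v w v' w'
    using g'(2)[of "(v, w)" "(v', w')"] that by simp
  have smult: "c \<odot>\<^bsub>T\<^esub> g (v, w) = g (c \<odot>\<^bsub>V\<^esub> v, c \<odot>\<^bsub>W\<^esub> w)"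
    if "c \<in> carrier F" "v \<in> carrier V" "w \<in> carrier W" for c v w
    using g'(3)[of c "(v, w)"] that by simp
  have act: "lact T a (g (v, w)) = g (lact V a v \<oplus>\<^bsub>V\<^esub> \<phi> a w, lact W a w)"
    "ract T (g (v, w)) a = g (ract V v a \<oplus>\<^bsub>V\<^esub> \<psi> w a, ract W w a)"
    if "a \<in> carrier A" "v \<in> carrier V" "w \<in> carrier W" for a v w
    using g'(4,5)[of a "(v, w)"] that by simp_all
  have i_hom: "i \<in> kv_hom F A V T"
    unfolding kv_hom_iff by (simp add: i closed add smult act lin act_linear)
  have p_hom: "p \<in> kv_hom F A T W"
    unfolding kv_hom_iff Tg by (auto simp: p add smult act lin)
  have i_inj: "inj_on i (carrier V)"
    using inj_onD[OF inj] by (intro inj_onI) (force simp: i)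
  have ker: "i ` carrier V = a_kernel T W p"
    unfolding a_kernel_def' Tg by (auto simp: i p image_iff)
  have p_surj: "p ` carrier T = carrier W"
    unfolding Tg image_image using V.W.M.zero_closed by (force simp: p image_iff)
  define U where "U = (\<lambda>w. g (\<zero>\<^bsub>V\<^esub>, w)) ` carrier W"
  have "submodule U F T"
  proof (rule T.submoduleI)
    fix x assume "x \<in> U"
    then obtain w where w: "w \<in> carrier W" "x = g (\<zero>\<^bsub>V\<^esub>, w)" by (auto simp: U_def)
    have "\<ominus>\<^bsub>T\<^esub> x = (\<ominus>\<^bsub>F\<^esub> \<one>\<^bsub>F\<^esub>) \<odot>\<^bsub>T\<^esub> x"
      using w closed by (simp add: T.smult_l_minus)
    also have "\<dots> = g (\<zero>\<^bsub>V\<^esub>, (\<ominus>\<^bsub>F\<^esub> \<one>\<^bsub>F\<^esub>) \<odot>\<^bsub>W\<^esub> w)"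
      using w by (simp add: smult)
    also have "\<dots> \<in> U" using w by (simp add: U_def)
    finally show "\<ominus>\<^bsub>T\<^esub> x \<in> U" .
  next
    show "\<zero>\<^bsub>T\<^esub> \<in> U" unfolding U_def zero[symmetric] by (rule imageI) simp
  qed (auto simp: U_def closed add smult image_iff)
  moreover have "i ` carrier V \<inter> U = {\<zero>\<^bsub>T\<^esub>}"
  proof (intro equalityI subsetI)
    fix t assume "t \<in> i ` carrier V \<inter> U"
    then obtain v w where "v \<in> carrier V" "w \<in> carrier W" "t = g (v, \<zero>\<^bsub>W\<^esub>)" "t = g (\<zero>\<^bsub>V\<^esub>, w)"
      by (auto simp: U_def i)
    moreover from this have "(v, \<zero>\<^bsub>W\<^esub>) = (\<zero>\<^bsub>V\<^esub>, w)"
      by (intro inj_onD[OF inj]) auto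
    ultimately show "t \<in> {\<zero>\<^bsub>T\<^esub>}" by (metis Pair_inject zero singletonI)
  next
    fix t assume "t \<in> {\<zero>\<^bsub>T\<^esub>}"
    then have "t = i \<zero>\<^bsub>V\<^esub>" "t = g (\<zero>\<^bsub>V\<^esub>, \<zero>\<^bsub>W\<^esub>)" by (simp_all add: i zero)
    then show "t \<in> i ` carrier V \<inter> U"
      unfolding U_def by blast
  qed
  moreover have "i ` carrier V <+>\<^bsub>T\<^esub> U = carrier T"
    unfolding set_add_def' Tg U_def by (force simp: i add)
  ultimately show ?thesis
    using T i_hom p_hom i_inj ker p_surj
    by (auto simp: split_sequences_def exact_sequences_def splittable_def)
qed

text \<open>A complement \<open>U\<close> of \<open>i(V)\<close> is mapped isomorphically to \<open>W\<close> by \<open>p\<close>, and the inverse is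
a linear section \<open>\<sigma>\<close>. The elements \<open>a \<sigma>(w) - \<sigma>(a w)\<close> and \<open>\<sigma>(w) a - \<sigma>(w a)\<close> measure by how much \<open>\<sigma>\<close> fails to be a
morphism. They are in the kernel of \<open>p\<close>, hence in \<open>i(V)\<close>; their preimages are \<open>\<phi>(a, w)\<close> and
\<open>\<psi>(w, a)\<close>. With these, \<open>(v, w) \<mapsto> i(v) + \<sigma>(w)\<close> preserves the actions. The cocycle property
holds because the extension on \<open>V \<times> W\<close>, being isomorphic to \<open>T\<close>, is a KV-module.\<close>

lemma split_imp_sequence_iso_twisted:
  assumes s: "(T, i, p) \<in> split_sequences F A W V"
  obtains \<phi> \<psi> g where "extension_cocycle F A W V \<phi> \<psi>"
    "sequence_iso F A V g (twisted_sequence V W \<phi> \<psi>) (T, i, p)"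
proof -
  note T = split_sequencesD(1)[OF s] and i_hom = split_sequencesD(2)[OF s]
    and p_hom = split_sequencesD(3)[OF s] and i_inj = split_sequencesD(4)[OF s]
    and p_surj = split_sequencesD(6)[OF s]
  note T_module = kv_moduleD(2)[OF T] and T_closed = kv_moduleD(5,6)[OF T]
  interpret T: module F T by (rule T_module)
  interpret T': kv_module F A T by (rule T)
  note i' = kv_homD(1-5)[OF i_hom] and p' = kv_homD(1-5)[OF p_hom]
  have ker: "p t = \<zero>\<^bsub>W\<^esub> \<longleftrightarrow> t \<in> i ` carrier V" if "t \<in> carrier T" for t
    using split_sequencesD(5)[OF s] that by (simp add: a_kernel_def')
  have pi: "p (i v) = \<zero>\<^bsub>W\<^esub>" if "v \<in> carrier V" for v
    using ker[of "i v"] i'(1) that by simp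
  have p_minus: "p (x \<ominus>\<^bsub>T\<^esub> y) = \<zero>\<^bsub>W\<^esub>" if "x \<in> carrier T" "y \<in> carrier T" "p x = p y" for x y
    using linear_maps_minus[OF T_module W_module kv_homD(6)[OF p_hom]] that
    by (simp add: a_minus_def p' W.W.M.r_neg)
  obtain U where U: "submodule U F T" and disj: "i ` carrier V \<inter> U = {\<zero>\<^bsub>T\<^esub>}"
    and span: "i ` carrier V <+>\<^bsub>T\<^esub> U = carrier T"
    using split_sequencesD(7)[OF s] by blast
  note U' = T.submoduleE[OF U]
  have UT: "x \<in> carrier T" if "x \<in> U" for x using U'(1) that by blast
  have U_inj: "inj_on p U"
  proof (rule inj_onI)
    fix x y assume xy: "x \<in> U" "y \<in> U" "p x = p y"
    then have "p (x \<ominus>\<^bsub>T\<^esub> y) = \<zero>\<^bsub>W\<^esub>" by (simp add: p_minus UT)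
    then have "x \<ominus>\<^bsub>T\<^esub> y \<in> i ` carrier V" using ker xy UT by simp
    moreover have "x \<ominus>\<^bsub>T\<^esub> y \<in> U" using xy U'(3,5) by (simp add: a_minus_def)
    ultimately have "x \<ominus>\<^bsub>T\<^esub> y \<in> {\<zero>\<^bsub>T\<^esub>}"
      unfolding disj[symmetric] by (rule IntI)
    then have "\<zero>\<^bsub>T\<^esub> = x \<ominus>\<^bsub>T\<^esub> y" by (metis singletonD)
    then show "x = y" using xy UT by (simp add: T.M.eq_minus_iff)
  qed
  have decompose: "\<exists>v\<in>carrier V. \<exists>u\<in>U. t = i v \<oplus>\<^bsub>T\<^esub> u" if "t \<in> carrier T" for t
    using that unfolding span[symmetric] set_add_def' by auto
  \<comment> \<open>in \<open>t = i(v) + u\<close>, the first summand is in the kernel of \<open>p\<close>\<close>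
  have U_surj: "\<exists>u\<in>U. p u = w" if "w \<in> carrier W" for w
  proof -
    have "w \<in> p ` carrier T" using that p_surj by simp
    then obtain t where t: "t \<in> carrier T" "p t = w" by auto
    then obtain v u where vu: "v \<in> carrier V" "u \<in> U" "t = i v \<oplus>\<^bsub>T\<^esub> u"
      using decompose[of t] by blast
    then have "p u = w" using t by (simp add: p' i' pi UT)
    then show ?thesis using vu by blast
  qed
  define \<sigma> where "\<sigma> = inv_into U p"
  have \<sigma>: "\<sigma> w \<in> U" "p (\<sigma> w) = w" "\<sigma> w \<in> carrier T" if "w \<in> carrier W" for w
  proof -
    have "w \<in> p ` U" using U_surj[OF that] by blast
    then show "\<sigma> w \<in> U" "p (\<sigma> w) = w" unfolding \<sigma>_def by (rule inv_into_into f_inv_into_f)+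
    then show "\<sigma> w \<in> carrier T" by (simp add: UT)
  qed
  have \<sigma>_unique: "\<sigma> w = u" if "u \<in> U" "p u = w" for u w
    using U_inj that unfolding \<sigma>_def by (simp add: inv_into_f_eq)
  have \<sigma>_add: "\<sigma> (v \<oplus>\<^bsub>W\<^esub> w) = \<sigma> v \<oplus>\<^bsub>T\<^esub> \<sigma> w" if "v \<in> carrier W" "w \<in> carrier W" for v w
    by (rule \<sigma>_unique) (use that U'(5) in \<open>simp_all add: \<sigma> p'\<close>)
  have \<sigma>_smult: "\<sigma> (c \<odot>\<^bsub>W\<^esub> w) = c \<odot>\<^bsub>T\<^esub> \<sigma> w" if "c \<in> carrier F" "w \<in> carrier W" for c w
    by (rule \<sigma>_unique) (use that U'(4) in \<open>simp_all add: \<sigma> p'\<close>)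
  define \<phi> where "\<phi> a w = inv_into (carrier V) i (lact T a (\<sigma> w) \<ominus>\<^bsub>T\<^esub> \<sigma> (lact W a w))" for a w
  define \<psi> where "\<psi> w a = inv_into (carrier V) i (ract T (\<sigma> w) a \<ominus>\<^bsub>T\<^esub> \<sigma> (ract W w a))" for a w
  have \<phi>: "\<phi> a w \<in> carrier V" "lact T a (\<sigma> w) = i (\<phi> a w) \<oplus>\<^bsub>T\<^esub> \<sigma> (lact W a w)"
    and \<psi>: "\<psi> w a \<in> carrier V" "ract T (\<sigma> w) a = i (\<psi> w a) \<oplus>\<^bsub>T\<^esub> \<sigma> (ract W w a)"
    if aw: "a \<in> carrier A" "w \<in> carrier W" for a w
  proof -
    have "p (lact T a (\<sigma> w) \<ominus>\<^bsub>T\<^esub> \<sigma> (lact W a w)) = \<zero>\<^bsub>W\<^esub>"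
      "p (ract T (\<sigma> w) a \<ominus>\<^bsub>T\<^esub> \<sigma> (ract W w a)) = \<zero>\<^bsub>W\<^esub>"
      using aw by (simp_all add: p_minus \<sigma> T_closed p')
    then have mem: "lact T a (\<sigma> w) \<ominus>\<^bsub>T\<^esub> \<sigma> (lact W a w) \<in> i ` carrier V"
      "ract T (\<sigma> w) a \<ominus>\<^bsub>T\<^esub> \<sigma> (ract W w a) \<in> i ` carrier V"
      using aw by (simp_all add: ker \<sigma> T_closed)
    show V: "\<phi> a w \<in> carrier V" "\<psi> w a \<in> carrier V"
      unfolding \<phi>_def \<psi>_def using mem by (auto intro: inv_into_into)
    have "i (\<phi> a w) = lact T a (\<sigma> w) \<ominus>\<^bsub>T\<^esub> \<sigma> (lact W a w)"
      "i (\<psi> w a) = ract T (\<sigma> w) a \<ominus>\<^bsub>T\<^esub> \<sigma> (ract W w a)"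
      unfolding \<phi>_def \<psi>_def using mem by (auto intro: f_inv_into_f)
    then show "lact T a (\<sigma> w) = i (\<phi> a w) \<oplus>\<^bsub>T\<^esub> \<sigma> (lact W a w)"
      "ract T (\<sigma> w) a = i (\<psi> w a) \<oplus>\<^bsub>T\<^esub> \<sigma> (ract W w a)"
      using aw V by (simp_all add: T.M.eq_minus_iff i' \<sigma> T_closed)
  qed
  define g where "g = (\<lambda>(v, w). i v \<oplus>\<^bsub>T\<^esub> \<sigma> w)"
  let ?M = "twisted_sum V W \<phi> \<psi>"
  have g_hom: "g \<in> kv_hom F A ?M T"
    unfolding kv_hom_iff g_def
    by (auto simp: i' \<sigma> \<sigma>_add \<sigma>_smult T.smult_r_distr T'.lact_linear T'.ract_linear \<phi> \<psi> T_closed T.M.a_ac)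
  have g_inj: "inj_on g (carrier ?M)"
  proof (rule inj_onI, clarsimp simp: g_def)
    fix v w v' w'
    assume *: "v \<in> carrier V" "w \<in> carrier W" "v' \<in> carrier V" "w' \<in> carrier W"
      and eq: "i v \<oplus>\<^bsub>T\<^esub> \<sigma> w = i v' \<oplus>\<^bsub>T\<^esub> \<sigma> w'"
    have "w = w'" using arg_cong[OF eq, of p] * by (simp add: p' i' \<sigma> pi)
    moreover from this have "i v = i v'" using eq * by (simp add: i' \<sigma>)
    then have "v = v'" using * i_inj by (simp add: inj_onD)
    ultimately show "v = v' \<and> w = w'" by simp
  qed
  have g_surj: "carrier T \<subseteq> g ` carrier ?M"
  proof
    fix t assume "t \<in> carrier T"
    then obtain v u where vu: "v \<in> carrier V" "u \<in> U" "t = i v \<oplus>\<^bsub>T\<^esub> u"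
      using decompose[of t] by blast
    then have "t = g (v, p u)" using \<sigma>_unique[of u "p u"] by (simp add: g_def)
    moreover have "(v, p u) \<in> carrier ?M" using vu UT p' by simp
    ultimately show "t \<in> g ` carrier ?M" by blast
  qed
  have g_bij: "bij_betw g (carrier ?M) (carrier T)"
    using g_inj g_surj kv_homD(1)[OF g_hom] unfolding bij_betw_def by blast
  have M_module: "module F ?M" by (rule twisted_sum_module[OF V_module W_module])
  interpret M: module F ?M by (rule M_module)
  have "kv_module F A ?M"
    by (rule kv_module_transport[OF T g_inj _ _ _ _ _ _ g_hom])
      (auto simp: \<phi> \<psi> linear_maps_zero[OF M_module T_module kv_homD(6)[OF g_hom], simplified])
  then have coc: "extension_cocycle F A W V \<phi> \<psi>"
    by (simp add: extension_cocycle_iff_kv_module \<phi> \<psi>)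
  have \<sigma>_zero: "\<sigma> \<zero>\<^bsub>W\<^esub> = \<zero>\<^bsub>T\<^esub>"
    by (rule linear_maps_zero[OF W_module T_module]) (simp add: linear_maps_iff \<sigma> \<sigma>_add \<sigma>_smult)
  have "sequence_iso F A V g (twisted_sequence V W \<phi> \<psi>) (T, i, p)"
    using g_hom g_bij
    by (auto simp: sequence_iso_def twisted_sequence_def g_def \<sigma>_zero i' p' \<sigma> pi)
  with coc show ?thesis by (rule that)
qed

section \<open>Equivalent extensions and cohomologous cocycles\<close>

text \<open>The two differences are the components of \<open>\<delta> \<theta>\<close>.\<close>

definition cohomologous_by :: "('w \<Rightarrow> 'v) \<Rightarrow> ('a \<Rightarrow> 'w \<Rightarrow> 'v) \<Rightarrow> ('w \<Rightarrow> 'a \<Rightarrow> 'v)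
    \<Rightarrow> ('a \<Rightarrow> 'w \<Rightarrow> 'v) \<Rightarrow> ('w \<Rightarrow> 'a \<Rightarrow> 'v) \<Rightarrow> bool" where
  "cohomologous_by \<theta> \<phi> \<psi> \<phi>' \<psi>' \<longleftrightarrow> (\<forall>a\<in>carrier A. \<forall>w\<in>carrier W.
     \<phi>' a w = (\<theta> (lact W a w) \<ominus>\<^bsub>V\<^esub> lact V a (\<theta> w)) \<oplus>\<^bsub>V\<^esub> \<phi> a w \<and>
     \<psi>' w a = (\<theta> (ract W w a) \<ominus>\<^bsub>V\<^esub> ract V (\<theta> w) a) \<oplus>\<^bsub>V\<^esub> \<psi> w a)"

text \<open>Without differences, the condition says that \<open>(v, w) \<mapsto> (v + \<theta>(w), w)\<close> preserves the actions.\<close>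

lemma cohomologous_by_iff:
  assumes "\<theta> \<in> linear_maps F W V"
    and "\<forall>a\<in>carrier A. \<forall>w\<in>carrier W. \<phi> a w \<in> carrier V \<and> \<psi> w a \<in> carrier V"
    and "\<forall>a\<in>carrier A. \<forall>w\<in>carrier W. \<phi>' a w \<in> carrier V \<and> \<psi>' w a \<in> carrier V"
  shows "cohomologous_by \<theta> \<phi> \<psi> \<phi>' \<psi>' \<longleftrightarrow> (\<forall>a\<in>carrier A. \<forall>w\<in>carrier W.
     lact V a (\<theta> w) \<oplus>\<^bsub>V\<^esub> \<phi>' a w = \<phi> a w \<oplus>\<^bsub>V\<^esub> \<theta> (lact W a w) \<and>
     ract V (\<theta> w) a \<oplus>\<^bsub>V\<^esub> \<psi>' w a = \<psi> w a \<oplus>\<^bsub>V\<^esub> \<theta> (ract W w a))"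
proof -
  have move: "z = (x \<ominus>\<^bsub>V\<^esub> y) \<oplus>\<^bsub>V\<^esub> u \<longleftrightarrow> y \<oplus>\<^bsub>V\<^esub> z = u \<oplus>\<^bsub>V\<^esub> x"
    if "x \<in> carrier V" "y \<in> carrier V" "z \<in> carrier V" "u \<in> carrier V" for x y z u
  proof -
    have "(x \<ominus>\<^bsub>V\<^esub> y) \<oplus>\<^bsub>V\<^esub> u = (x \<oplus>\<^bsub>V\<^esub> u) \<ominus>\<^bsub>V\<^esub> y"
      using that by (simp add: a_minus_def V.W.M.a_ac)
    moreover have "z = (x \<oplus>\<^bsub>V\<^esub> u) \<ominus>\<^bsub>V\<^esub> y \<longleftrightarrow> z \<oplus>\<^bsub>V\<^esub> y = x \<oplus>\<^bsub>V\<^esub> u"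
      using that by (simp add: V.W.M.eq_minus_iff)
    ultimately show ?thesis using that by (metis V.W.M.a_comm)
  qed
  show ?thesis
    unfolding cohomologous_by_def using assms by (simp add: move linear_maps_iff)
qed

lemma sequence_iso_shift:
  assumes \<theta>: "\<theta> \<in> linear_maps F W V"
    and c: "\<forall>a\<in>carrier A. \<forall>w\<in>carrier W. \<phi> a w \<in> carrier V \<and> \<psi> w a \<in> carrier V"
    and c': "\<forall>a\<in>carrier A. \<forall>w\<in>carrier W. \<phi>' a w \<in> carrier V \<and> \<psi>' w a \<in> carrier V"
    and coh: "cohomologous_by \<theta> \<phi> \<psi> \<phi>' \<psi>'"
  shows "sequence_iso F A V (\<lambda>(v, w). (v \<oplus>\<^bsub>V\<^esub> \<theta> w, w))
    (twisted_sequence V W \<phi> \<psi>) (twisted_sequence V W \<phi>' \<psi>')"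
proof -
  have \<theta>_closed: "\<And>w. w \<in> carrier W \<Longrightarrow> \<theta> w \<in> carrier V"
    and \<theta>_add: "\<And>v w. \<lbrakk>v \<in> carrier W; w \<in> carrier W\<rbrakk> \<Longrightarrow> \<theta> (v \<oplus>\<^bsub>W\<^esub> w) = \<theta> v \<oplus>\<^bsub>V\<^esub> \<theta> w"
    and \<theta>_smult: "\<And>c w. \<lbrakk>c \<in> carrier F; w \<in> carrier W\<rbrakk> \<Longrightarrow> \<theta> (c \<odot>\<^bsub>W\<^esub> w) = c \<odot>\<^bsub>V\<^esub> \<theta> w"
    using \<theta> by (simp_all add: linear_maps_iff)
  have eq: "lact V a (\<theta> w) \<oplus>\<^bsub>V\<^esub> \<phi>' a w = \<phi> a w \<oplus>\<^bsub>V\<^esub> \<theta> (lact W a w)"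
    "ract V (\<theta> w) a \<oplus>\<^bsub>V\<^esub> \<psi>' w a = \<psi> w a \<oplus>\<^bsub>V\<^esub> \<theta> (ract W w a)"
    if "a \<in> carrier A" "w \<in> carrier W" for a w
    using coh that unfolding cohomologous_by_iff[OF \<theta> c c'] by blast+
  let ?g = "\<lambda>(v, w). (v \<oplus>\<^bsub>V\<^esub> \<theta> w, w)"
  have "?g \<in> kv_hom F A (twisted_sum V W \<phi> \<psi>) (twisted_sum V W \<phi>' \<psi>')"
    unfolding kv_hom_iff
    by (auto simp: \<theta>_closed \<theta>_add \<theta>_smult c c' act_linear V.W.smult_r_distr eq V.W.M.a_assoc)
      (auto simp: \<theta>_closed V.W.M.a_ac)
  moreover have "bij_betw ?g (carrier V \<times> carrier W) (carrier V \<times> carrier W)"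
    by (rule bij_betw_byWitness[where f' = "\<lambda>(v, w). (v \<ominus>\<^bsub>V\<^esub> \<theta> w, w)"])
      (auto simp: \<theta>_closed a_minus_def V.W.M.a_assoc V.W.M.l_neg V.W.M.r_neg)
  moreover have "\<theta> \<zero>\<^bsub>W\<^esub> = \<zero>\<^bsub>V\<^esub>" by (rule linear_maps_zero[OF W_module V_module \<theta>])
  ultimately show ?thesis
    by (auto simp: sequence_iso_def twisted_sequence_def)
qed

text \<open>As \<open>g\<close> is the identity on \<open>V\<close> and induces the identity on \<open>W\<close>, it is determined by the first
coordinate of \<open>g(0, w)\<close>, which is \<open>\<theta>(w)\<close>.\<close>

lemma sequence_iso_imp_cohomologous:
  assumes c: "\<forall>a\<in>carrier A. \<forall>w\<in>carrier W. \<phi> a w \<in> carrier V \<and> \<psi> w a \<in> carrier V"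
    and c': "\<forall>a\<in>carrier A. \<forall>w\<in>carrier W. \<phi>' a w \<in> carrier V \<and> \<psi>' w a \<in> carrier V"
    and iso: "sequence_iso F A V g (twisted_sequence V W \<phi> \<psi>) (twisted_sequence V W \<phi>' \<psi>')"
  shows "\<exists>\<theta>\<in>linear_maps F W V. cohomologous_by \<theta> \<phi> \<psi> \<phi>' \<psi>'"
proof -
  let ?M = "twisted_sum V W \<phi> \<psi>" and ?M' = "twisted_sum V W \<phi>' \<psi>'"
  have g: "g \<in> kv_hom F A ?M ?M'"
    and gi: "\<And>v. v \<in> carrier V \<Longrightarrow> g (v, \<zero>\<^bsub>W\<^esub>) = (v, \<zero>\<^bsub>W\<^esub>)"
    and pg: "\<And>v w. \<lbrakk>v \<in> carrier V; w \<in> carrier W\<rbrakk> \<Longrightarrow> snd (g (v, w)) = w"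
    using iso by (auto simp: sequence_iso_def twisted_sequence_def)
  note g' = kv_homD[OF g]
  define \<theta> where "\<theta> w = fst (g (\<zero>\<^bsub>V\<^esub>, w))" for w
  have g0: "g (\<zero>\<^bsub>V\<^esub>, w) = (\<theta> w, w)" if "w \<in> carrier W" for w
    using pg[of "\<zero>\<^bsub>V\<^esub>" w] that by (simp add: \<theta>_def prod_eq_iff)
  have \<theta>_closed: "\<theta> w \<in> carrier V" if "w \<in> carrier W" for w
    using g'(1)[of "(\<zero>\<^bsub>V\<^esub>, w)"] that by (simp add: g0)
  have \<theta>: "\<theta> \<in> linear_maps F W V"
    unfolding linear_maps_iff
  proof (intro conjI ballI)
    fix v w assume "v \<in> carrier W" "w \<in> carrier W"
    then show "\<theta> (v \<oplus>\<^bsub>W\<^esub> w) = \<theta> v \<oplus>\<^bsub>V\<^esub> \<theta> w"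
      using g'(2)[of "(\<zero>\<^bsub>V\<^esub>, v)" "(\<zero>\<^bsub>V\<^esub>, w)"] by (simp add: g0)
  next
    fix c w assume "c \<in> carrier F" "w \<in> carrier W"
    then show "\<theta> (c \<odot>\<^bsub>W\<^esub> w) = c \<odot>\<^bsub>V\<^esub> \<theta> w"
      using g'(3)[of c "(\<zero>\<^bsub>V\<^esub>, w)"] by (simp add: g0)
  qed (rule \<theta>_closed)
  have g_eq: "g (v, w) = (v \<oplus>\<^bsub>V\<^esub> \<theta> w, w)" if "v \<in> carrier V" "w \<in> carrier W" for v w
    using g'(2)[of "(v, \<zero>\<^bsub>W\<^esub>)" "(\<zero>\<^bsub>V\<^esub>, w)"] that by (simp add: g0 gi)
  have "cohomologous_by \<theta> \<phi> \<psi> \<phi>' \<psi>'"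
    unfolding cohomologous_by_iff[OF \<theta> c c']
  proof (intro ballI conjI)
    fix a w assume "a \<in> carrier A" "w \<in> carrier W"
    then show "lact V a (\<theta> w) \<oplus>\<^bsub>V\<^esub> \<phi>' a w = \<phi> a w \<oplus>\<^bsub>V\<^esub> \<theta> (lact W a w)"
      "ract V (\<theta> w) a \<oplus>\<^bsub>V\<^esub> \<psi>' w a = \<psi> w a \<oplus>\<^bsub>V\<^esub> \<theta> (ract W w a)"
      using g'(4,5)[of a "(\<zero>\<^bsub>V\<^esub>, w)"] c
      by (simp_all add: g0 g_eq \<theta>_closed V.lact_linear(5) V.ract_linear(5))
  qed
  with \<theta> show ?thesis by blast
qed

end

section \<open>The bijection\<close>

text \<open>The structure carried by the image of the middle term under an injective map \<open>h\<close>. It moves an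
extension on pairs into the type in which the sequences are classified.\<close>

definition transport_sequence ::
    "('s \<Rightarrow> 't) \<Rightarrow> ('f, 'a, 'v, 's, 'w) sequence \<Rightarrow> ('f, 'a, 'v, 't, 'w) sequence" where
  "transport_sequence h = (\<lambda>(T, i, p). let k = inv_into (carrier T) h in
     (\<lparr>carrier = h ` carrier T, mult = undefined, one = undefined,
       zero = h \<zero>\<^bsub>T\<^esub>,
       add = (\<lambda>x y. h (k x \<oplus>\<^bsub>T\<^esub> k y)),
       smult = (\<lambda>c x. h (c \<odot>\<^bsub>T\<^esub> k x)),
       lact = (\<lambda>a x. h (lact T a (k x))),
       ract = (\<lambda>x a. h (ract T (k x) a))\<rparr>,
      \<lambda>v. h (i v), \<lambda>x. p (k x)))"

lemma transport_sequence_iso: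
  assumes T: "kv_module F A T" and inj: "inj_on h (carrier T)"
  shows "sequence_iso F A V h (T, i, p) (transport_sequence h (T, i, p))"
    and "kv_module F A (fst (transport_sequence h (T, i, p)))"
proof -
  interpret T: module F T by (rule kv_moduleD(2)[OF T])
  let ?T' = "fst (transport_sequence h (T, i, p))"
  have bij: "bij_betw h (carrier T) (carrier ?T')"
    using inj by (simp add: transport_sequence_def Let_def bij_betw_def)
  have hom: "h \<in> kv_hom F A T ?T'"
    unfolding kv_hom_iff by (simp add: transport_sequence_def Let_def inj)
  show "sequence_iso F A V h (T, i, p) (transport_sequence h (T, i, p))"
    using bij hom inj by (simp add: sequence_iso_def transport_sequence_def Let_def)
  show "kv_module F A ?T'"
    by (rule kv_module_iso_image[OF T hom bij]) (simp add: transport_sequence_def Let_def)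
qed

text \<open>If \<open>\<tau>\<close> meets every class and the sets \<open>cls z\<close> are the fibres of the induced map to the quotient, then
sending a fibre to the class of its image is a bijection.\<close>

lemma bij_betw_fibres_quotient:
  assumes R: "equiv S R" and maps: "\<And>z. z \<in> Z \<Longrightarrow> \<tau> z \<in> S"
    and cls: "\<And>z. z \<in> Z \<Longrightarrow> cls z = {z' \<in> Z. (\<tau> z, \<tau> z') \<in> R}"
    and surj: "\<And>s. s \<in> S \<Longrightarrow> \<exists>z\<in>Z. (\<tau> z, s) \<in> R"
  shows "bij_betw (\<lambda>C. R `` (\<tau> ` C)) (cls ` Z) (S // R)"
proof -
  have refl: "(\<tau> z, \<tau> z) \<in> R" if "z \<in> Z" for z
    using R maps[OF that] by (simp add: equiv_def refl_on_def)
  have eq: "R `` (\<tau> ` cls z) = R `` {\<tau> z}" if z: "z \<in> Z" for z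
  proof
    show "R `` (\<tau> ` cls z) \<subseteq> R `` {\<tau> z}"
      using R unfolding cls[OF z] equiv_def trans_def by blast
    show "R `` {\<tau> z} \<subseteq> R `` (\<tau> ` cls z)"
      using refl[OF z] z unfolding cls[OF z] by blast
  qed
  show ?thesis
  proof (rule bij_betw_imageI)
    show "inj_on (\<lambda>C. R `` (\<tau> ` C)) (cls ` Z)"
    proof (rule inj_onI, elim imageE, hypsubst)
      fix z z' assume z: "z \<in> Z" "z' \<in> Z" and "R `` (\<tau> ` cls z) = R `` (\<tau> ` cls z')"
      then have "(\<tau> z, \<tau> z') \<in> R"
        using eq_equiv_class[OF _ R maps[OF z(2)], of "\<tau> z"] by (simp add: eq)
      then show "cls z = cls z'"
        using R unfolding cls[OF z(1)] cls[OF z(2)] equiv_def trans_def sym_def by blast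
    qed
    have "(\<lambda>C. R `` (\<tau> ` C)) ` cls ` Z = (\<lambda>z. R `` {\<tau> z}) ` Z"
      unfolding image_image by (rule image_cong) (simp_all add: eq)
    also have "\<dots> = S // R"
    proof
      show "(\<lambda>z. R `` {\<tau> z}) ` Z \<subseteq> S // R" using maps by (auto intro: quotientI)
      show "S // R \<subseteq> (\<lambda>z. R `` {\<tau> z}) ` Z"
      proof
        fix c assume "c \<in> S // R"
        then obtain s where s: "s \<in> S" "c = R `` {s}" by (rule quotientE)
        then obtain z where z: "z \<in> Z" "(\<tau> z, s) \<in> R" using surj by blast
        have "R `` {\<tau> z} = c" using equiv_class_eq[OF R z(2)] s by simp
        then show "c \<in> (\<lambda>z. R `` {\<tau> z}) ` Z" using z(1) by blast
      qed
    qed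
    finally show "(\<lambda>C. R `` (\<tau> ` C)) ` cls ` Z = S // R" .
  qed
qed

lemma equiv_equivalent_sequences:
  fixes V :: "('f, 'a, 'v, 'u) kv_mod_scheme"
  shows "equiv (split_sequences F A W V)
    {(s, s') \<in> split_sequences F A W V \<times> split_sequences F A W V. equivalent_sequences F A V s s'}"
    (is "equiv ?S ?R")
proof (rule equivI)
  show "?R \<subseteq> ?S \<times> ?S" by blast
  show "refl_on ?S ?R"
    unfolding refl_on_def using sequence_iso_refl[of F A V] by (auto simp: equivalent_sequences_iff)
  show "sym ?R"
  proof (rule symI)
    fix s s' assume "(s, s') \<in> ?R"
    then obtain g where s: "s \<in> ?S" "s' \<in> ?S" and g: "sequence_iso F A V g s s'"
      by (auto simp: equivalent_sequences_iff)
    obtain T i p where T: "s = (T, i, p)" by (cases s) auto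
    have "kv_module F A T" "i \<in> kv_hom F A V T"
      using split_sequencesD(1,2) s(1) unfolding T by blast+
    then have "sequence_iso F A V (inv_into (carrier T) g) s' s"
      using sequence_iso_sym[OF g[unfolded T]] by (simp add: T kv_hom_iff)
    then show "(s', s) \<in> ?R" using s by (auto simp: equivalent_sequences_iff)
  qed
  show "trans ?R"
    unfolding trans_def by (auto simp: equivalent_sequences_iff intro: sequence_iso_trans)
qed

context kv_module_pair
begin

text \<open>The shift by \<open>\<theta>\<close> carries one module structure on \<open>V \<times> W\<close> to the other. In particular, adding a
coboundary to a cocycle gives a cocycle.\<close>

lemma extension_cocycle_shift:
  assumes coc: "extension_cocycle F A W V \<phi> \<psi>" and \<theta>: "\<theta> \<in> linear_maps F W V"
    and c': "\<forall>a\<in>carrier A. \<forall>w\<in>carrier W. \<phi>' a w \<in> carrier V \<and> \<psi>' w a \<in> carrier V"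
    and coh: "cohomologous_by \<theta> \<phi> \<psi> \<phi>' \<psi>'"
  shows "extension_cocycle F A W V \<phi>' \<psi>'"
proof -
  note c = coc[unfolded extension_cocycle_iff_kv_module, THEN conjunct1]
    and M = coc[unfolded extension_cocycle_iff_kv_module, THEN conjunct2]
  let ?g = "\<lambda>(v, w). (v \<oplus>\<^bsub>V\<^esub> \<theta> w, w)"
  have "?g \<in> kv_hom F A (twisted_sum V W \<phi> \<psi>) (twisted_sum V W \<phi>' \<psi>')"
      "bij_betw ?g (carrier (twisted_sum V W \<phi> \<psi>)) (carrier (twisted_sum V W \<phi>' \<psi>'))"
    using sequence_iso_shift[OF \<theta> c c' coh] by (simp_all add: sequence_iso_def twisted_sequence_def)
  then have "kv_module F A (twisted_sum V W \<phi>' \<psi>')"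
    by (rule kv_module_iso_image[OF M]) (simp add: linear_maps_zero[OF W_module V_module \<theta>])
  then show ?thesis using c' by (simp add: extension_cocycle_iff_kv_module)
qed

lemma bilinear_cochain_cong:
  assumes "\<And>a w. \<lbrakk>a \<in> carrier A; w \<in> carrier W\<rbrakk> \<Longrightarrow> \<phi> a w = \<phi>' a w \<and> \<psi> w a = \<psi>' w a"
  shows "bilinear_cochain A W V \<phi> \<psi> = bilinear_cochain A W V \<phi>' \<psi>'"
  unfolding bilinear_cochain_def by (rule restrict_ext) (auto simp: tuples_iff assms)

text \<open>The components are recovered by the arguments \<open>((a, 0), (0, w))\<close> and \<open>((0, w), (a, 0))\<close>, where the
other component contributes its value at \<open>(0, 0)\<close>.\<close>

lemma bilinear_cochain_eq_iff:
  assumes "\<phi> \<in> bilinear_maps F A W V" "\<psi> \<in> bilinear_maps F W A V"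
    and c': "\<forall>a\<in>carrier A. \<forall>w\<in>carrier W. \<phi>' a w \<in> carrier V \<and> \<psi>' w a \<in> carrier V"
    and z': "\<phi>' \<zero>\<^bsub>A\<^esub> \<zero>\<^bsub>W\<^esub> = \<zero>\<^bsub>V\<^esub>" "\<psi>' \<zero>\<^bsub>W\<^esub> \<zero>\<^bsub>A\<^esub> = \<zero>\<^bsub>V\<^esub>"
  shows "bilinear_cochain A W V \<phi> \<psi> = bilinear_cochain A W V \<phi>' \<psi>' \<longleftrightarrow>
    (\<forall>a\<in>carrier A. \<forall>w\<in>carrier W. \<phi> a w = \<phi>' a w \<and> \<psi> w a = \<psi>' w a)" (is "?L \<longleftrightarrow> ?R")
proof
  note lin = bilinear_mapsD(1)[OF assms(1)] bilinear_mapsD(1)[OF assms(2)]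
    bilinear_maps_zero[OF A_module W_module V_module assms(1)]
    bilinear_maps_zero[OF W_module A_module V_module assms(2)]
  assume eq: ?L
  show ?R
  proof (intro ballI conjI)
    fix a w assume aw: "a \<in> carrier A" "w \<in> carrier W"
    show "\<phi> a w = \<phi>' a w"
      using fun_cong[OF eq, of "[(a, \<zero>\<^bsub>W\<^esub>), (\<zero>\<^bsub>A\<^esub>, w)]"] aw c' z'
      by (simp add: bilinear_cochain_apply lin)
    show "\<psi> w a = \<psi>' w a"
      using fun_cong[OF eq, of "[(\<zero>\<^bsub>A\<^esub>, w), (a, \<zero>\<^bsub>W\<^esub>)]"] aw c' z'
      by (simp add: bilinear_cochain_apply lin)
  qed
qed (auto intro: bilinear_cochain_cong)

lemma coboundary_add_bilinear_cochain:
  assumes \<theta>: "\<theta> \<in> linear_maps F W V"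
    and \<phi>: "\<phi> \<in> bilinear_maps F A W V" and \<psi>: "\<psi> \<in> bilinear_maps F W A V"
  shows "bicoboundary F A W V 1 (linear_cochain A W \<theta>) \<oplus>\<^bsub>bicochains F A W V 1 1\<^esub>
      bilinear_cochain A W V \<phi> \<psi> =
    bilinear_cochain A W V (\<lambda>a w. (\<theta> (lact W a w) \<ominus>\<^bsub>V\<^esub> lact V a (\<theta> w)) \<oplus>\<^bsub>V\<^esub> \<phi> a w)
      (\<lambda>w a. (\<theta> (ract W w a) \<ominus>\<^bsub>V\<^esub> ract V (\<theta> w) a) \<oplus>\<^bsub>V\<^esub> \<psi> w a)" (is "?l = ?r")
proof (rule extensionalityI)
  let ?B = "semidirect A W"
  have add: "f \<oplus>\<^bsub>bicochains F A W V 1 1\<^esub> g = (\<lambda>bs\<in>tuples ?B (Suc (Suc 0)). f bs \<oplus>\<^bsub>V\<^esub> g bs)" for f g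
    by (simp add: bicochains_def cochains_def)
  show "?l \<in> extensional (tuples ?B (Suc (Suc 0)))" unfolding add by simp
  show "?r \<in> extensional (tuples ?B (Suc (Suc 0)))" by (simp add: bilinear_cochain_def)
  fix bs assume bs: "bs \<in> tuples ?B (Suc (Suc 0))"
  then show "?l bs = ?r bs"
    unfolding coboundary_linear_cochain[OF \<theta>] add using \<theta> bilinear_mapsD(1)[OF \<phi>] bilinear_mapsD(1)[OF \<psi>]
    by (auto simp: tuples_iff bilinear_cochain_apply linear_maps_iff V.W.M.a_ac)
qed

lemma E1_11_bij_Ext:
  fixes emb :: "'v \<times> 'w \<Rightarrow> 't"
  assumes emb: "inj_on emb (carrier V \<times> carrier W)"
  shows "\<exists>\<Phi> :: (('a \<times> 'w) list \<Rightarrow> 'v) set \<Rightarrow> ('f, 'a, 'v, 't, 'w) sequence set.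
    bij_betw \<Phi> (E1_11 F A W V) (Ext F A W V)"
proof -
  let ?C = "bicochains F A W V 1 1" and ?bc = "bilinear_cochain A W V"
  let ?coc = "extension_cocycle F A W V"
  define Z where "Z = a_kernel ?C (bicochains F A W V 1 2) (bicoboundary F A W V 2)"
  define B where "B = bicoboundary F A W V 1 ` carrier (bicochains F A W V 1 0)"
  define cls where "cls z = B +>\<^bsub>?C\<lparr>carrier := Z\<rparr>\<^esub> z" for z
  define S where "S = (split_sequences F A W V :: ('f, 'a, 'v, 't, 'w) sequence set)"
  define R where "R = {(s, s') \<in> S \<times> S. equivalent_sequences F A V s s'}"
  have E1: "E1_11 F A W V = cls ` Z"
    by (auto simp: E1_11_def Let_def A_RCOSETS_def' cls_def Z_def B_def)
  have Ext: "Ext F A W V = S // R"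
    by (simp add: Ext_def Let_def S_def R_def split_sequences_def)
  have Z: "Z = {?bc \<phi> \<psi> |\<phi> \<psi>. ?coc \<phi> \<psi>}"
    unfolding Z_def by (rule kernel_eq)
  then have "\<forall>z\<in>Z. \<exists>\<phi> \<psi>. ?coc \<phi> \<psi> \<and> z = ?bc \<phi> \<psi>" by blast
  then obtain \<phi> \<psi> where coc: "\<And>z. z \<in> Z \<Longrightarrow> ?coc (\<phi> z) (\<psi> z)"
    and z_eq: "\<And>z. z \<in> Z \<Longrightarrow> z = ?bc (\<phi> z) (\<psi> z)" by metis
  have coc_closed: "\<forall>a\<in>carrier A. \<forall>w\<in>carrier W. f a w \<in> carrier V \<and> g w a \<in> carrier V"
    if "?coc f g" for f g
    using that by (simp add: extension_cocycle_iff_kv_module)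
  have coc_bilinear: "f \<in> bilinear_maps F A W V" "g \<in> bilinear_maps F W A V" if "?coc f g" for f g
    using that by (simp_all add: extension_cocycle_def)
  have cls: "cls (?bc f g) = {?bc f' g' |f' g'. ?coc f' g' \<and>
      (\<exists>\<theta>\<in>linear_maps F W V. cohomologous_by \<theta> f g f' g')}" (is "_ = ?X") if c: "?coc f g" for f g
  proof -
    \<comment> \<open>components of the sum of \<open>\<delta> \<theta>\<close> and the cochain of \<open>(f, g)\<close>\<close>
    define sl where "sl = (\<lambda>\<theta> a w. (\<theta> (lact W a w) \<ominus>\<^bsub>V\<^esub> lact V a (\<theta> w)) \<oplus>\<^bsub>V\<^esub> f a w)"
    define sr where "sr = (\<lambda>\<theta> w a. (\<theta> (ract W w a) \<ominus>\<^bsub>V\<^esub> ract V (\<theta> w) a) \<oplus>\<^bsub>V\<^esub> g w a)"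
    have coh: "cohomologous_by \<theta> f g (sl \<theta>) (sr \<theta>)" for \<theta>
      by (simp add: cohomologous_by_def sl_def sr_def)
    have coh_iff: "cohomologous_by \<theta> f g f' g' \<longleftrightarrow>
        (\<forall>a\<in>carrier A. \<forall>w\<in>carrier W. f' a w = sl \<theta> a w \<and> g' w a = sr \<theta> w a)" for \<theta> f' g'
      by (simp add: cohomologous_by_def sl_def sr_def)
    have sl_coc: "?coc (sl \<theta>) (sr \<theta>)" if "\<theta> \<in> linear_maps F W V" for \<theta>
      by (rule extension_cocycle_shift[OF c that _ coh])
        (use that coc_closed[OF c] in \<open>simp add: sl_def sr_def linear_maps_iff\<close>)
    have "cls (?bc f g) = (\<lambda>\<theta>. ?bc (sl \<theta>) (sr \<theta>)) ` linear_maps F W V"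
    proof -
      have "cls (?bc f g) = (\<lambda>b. b \<oplus>\<^bsub>?C\<^esub> ?bc f g) ` B"
        by (auto simp: cls_def a_r_coset_def')
      also have "\<dots> = (\<lambda>\<theta>. ?bc (sl \<theta>) (sr \<theta>)) ` linear_maps F W V"
        unfolding B_def bicochains_1_0 image_image
        by (rule image_cong[OF refl])
          (simp only: coboundary_add_bilinear_cochain[OF _ coc_bilinear[OF c]] sl_def sr_def)
      finally show ?thesis .
    qed
    also have "\<dots> = ?X"
    proof
      show "(\<lambda>\<theta>. ?bc (sl \<theta>) (sr \<theta>)) ` linear_maps F W V \<subseteq> ?X" using sl_coc coh by blast
      show "?X \<subseteq> (\<lambda>\<theta>. ?bc (sl \<theta>) (sr \<theta>)) ` linear_maps F W V"
      proof
        fix x assume "x \<in> ?X"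
        then obtain f' g' \<theta> where x: "x = ?bc f' g'" and \<theta>: "\<theta> \<in> linear_maps F W V"
          and "cohomologous_by \<theta> f g f' g'" by blast
        then have "x = ?bc (sl \<theta>) (sr \<theta>)"
          unfolding x coh_iff by (intro bilinear_cochain_cong) blast
        with \<theta> show "x \<in> (\<lambda>\<theta>. ?bc (sl \<theta>) (sr \<theta>)) ` linear_maps F W V" by blast
      qed
    qed
    finally show ?thesis .
  qed
  \<comment> \<open>a cochain determines its components on the carriers only, so the chosen ones may differ elsewhere\<close>
  have coc_agree: "\<forall>a\<in>carrier A. \<forall>w\<in>carrier W.
      f a w = \<phi> (?bc f g) a w \<and> g w a = \<psi> (?bc f g) w a" if c: "?coc f g" for f g
  proof -
    have bc: "?bc f g \<in> Z" using c Z by blast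
    note zero = bilinear_maps_zero[OF A_module W_module V_module coc_bilinear(1)[OF coc[OF bc]]]
      bilinear_maps_zero[OF W_module A_module V_module coc_bilinear(2)[OF coc[OF bc]]]
    show ?thesis
      by (subst bilinear_cochain_eq_iff[symmetric])
        (use coc_bilinear[OF c] coc_closed[OF coc[OF bc]] z_eq[OF bc] zero in simp_all)
  qed
  define \<tau> where "\<tau> z = transport_sequence emb (twisted_sequence V W (\<phi> z) (\<psi> z))" for z
  have twisted: "kv_module F A (twisted_sum V W (\<phi> z) (\<psi> z))" if "z \<in> Z" for z
    using coc[OF that] by (simp add: extension_cocycle_iff_kv_module)
  have \<tau>_iso: "sequence_iso F A V emb (twisted_sequence V W (\<phi> z) (\<psi> z)) (\<tau> z)"
    and \<tau>_module: "kv_module F A (fst (\<tau> z))" if "z \<in> Z" for z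
    using transport_sequence_iso[OF twisted[OF that], of emb] emb
    unfolding \<tau>_def twisted_sequence_def by simp_all
  have twisted_sym: "sequence_iso F A V (inv_into (carrier V \<times> carrier W) g) s (twisted_sequence V W (\<phi> z) (\<psi> z))"
    if "z \<in> Z" "sequence_iso F A V g (twisted_sequence V W (\<phi> z) (\<psi> z)) s" for z g
      and s :: "('f, 'a, 'v, 's, 'w) sequence"
    using sequence_iso_sym[OF that(2)[unfolded twisted_sequence_def] twisted[OF that(1)]]
    by (simp add: twisted_sequence_def)
  have \<tau>_S: "\<tau> z \<in> S" if "z \<in> Z" for z
    using sequence_iso_twisted_imp_split[OF coc[OF that], of "fst (\<tau> z)" emb "fst (snd (\<tau> z))" "snd (snd (\<tau> z))"]
      \<tau>_iso[OF that] \<tau>_module[OF that] by (simp add: S_def)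
  have R_iff: "(\<tau> z, \<tau> z') \<in> R \<longleftrightarrow>
      (\<exists>\<theta>\<in>linear_maps F W V. cohomologous_by \<theta> (\<phi> z) (\<psi> z) (\<phi> z') (\<psi> z'))"
    if z: "z \<in> Z" "z' \<in> Z" for z z'
  proof
    assume "(\<tau> z, \<tau> z') \<in> R"
    then obtain g where "sequence_iso F A V g (\<tau> z) (\<tau> z')"
      by (auto simp: R_def equivalent_sequences_iff)
    then show "\<exists>\<theta>\<in>linear_maps F W V. cohomologous_by \<theta> (\<phi> z) (\<psi> z) (\<phi> z') (\<psi> z')"
      using sequence_iso_imp_cohomologous[OF coc_closed[OF coc[OF z(1)]] coc_closed[OF coc[OF z(2)]]]
        sequence_iso_trans[OF sequence_iso_trans[OF \<tau>_iso[OF z(1)]] twisted_sym[OF z(2) \<tau>_iso[OF z(2)]]]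
      by blast
  next
    assume "\<exists>\<theta>\<in>linear_maps F W V. cohomologous_by \<theta> (\<phi> z) (\<psi> z) (\<phi> z') (\<psi> z')"
    then obtain \<theta> where "\<theta> \<in> linear_maps F W V" "cohomologous_by \<theta> (\<phi> z) (\<psi> z) (\<phi> z') (\<psi> z')" by blast
    then have "sequence_iso F A V (\<lambda>(v, w). (v \<oplus>\<^bsub>V\<^esub> \<theta> w, w))
        (twisted_sequence V W (\<phi> z) (\<psi> z)) (twisted_sequence V W (\<phi> z') (\<psi> z'))"
      using sequence_iso_shift coc_closed coc z by blast
    from sequence_iso_trans[OF sequence_iso_trans[OF twisted_sym[OF z(1) \<tau>_iso[OF z(1)]] this] \<tau>_iso[OF z(2)]]
    show "(\<tau> z, \<tau> z') \<in> R"
      using \<tau>_S z by (auto simp: R_def equivalent_sequences_iff)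
  qed
  have "cls z = {z' \<in> Z. (\<tau> z, \<tau> z') \<in> R}" if z: "z \<in> Z" for z
  proof -
    have eq: "cls z = {?bc f' g' |f' g'. ?coc f' g' \<and>
        (\<exists>\<theta>\<in>linear_maps F W V. cohomologous_by \<theta> (\<phi> z) (\<psi> z) f' g')}"
      using cls[OF coc[OF z]] z_eq[OF z] by simp
    have agree: "cohomologous_by \<theta> (\<phi> z) (\<psi> z) f' g' \<longleftrightarrow>
        cohomologous_by \<theta> (\<phi> z) (\<psi> z) (\<phi> (?bc f' g')) (\<psi> (?bc f' g'))" if c': "?coc f' g'" for \<theta> f' g'
      using coc_agree[OF c'] by (simp add: cohomologous_by_def)
    show ?thesis
    proof
      show "cls z \<subseteq> {z' \<in> Z. (\<tau> z, \<tau> z') \<in> R}"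
      proof
        fix x assume "x \<in> cls z"
        then obtain f' g' \<theta> where x: "x = ?bc f' g'" "?coc f' g'" "\<theta> \<in> linear_maps F W V"
          "cohomologous_by \<theta> (\<phi> z) (\<psi> z) f' g'" unfolding eq by blast
        moreover have "x \<in> Z" using x Z by blast
        ultimately show "x \<in> {z' \<in> Z. (\<tau> z, \<tau> z') \<in> R}"
          using agree z by (auto simp: R_iff)
      qed
      show "{z' \<in> Z. (\<tau> z, \<tau> z') \<in> R} \<subseteq> cls z"
      proof
        fix x assume "x \<in> {z' \<in> Z. (\<tau> z, \<tau> z') \<in> R}"
        then have x: "x \<in> Z" "\<exists>\<theta>\<in>linear_maps F W V. cohomologous_by \<theta> (\<phi> z) (\<psi> z) (\<phi> x) (\<psi> x)"
          using R_iff[OF z] by auto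
        then show "x \<in> cls z" unfolding eq using coc[OF x(1)] z_eq[OF x(1)] by blast
      qed
    qed
  qed
  moreover have "\<exists>z\<in>Z. (\<tau> z, s) \<in> R" if s: "s \<in> S" for s
  proof -
    obtain T i p where T: "s = (T, i, p)" by (cases s) auto
    obtain f g h where c: "?coc f g" and h: "sequence_iso F A V h (twisted_sequence V W f g) s"
      using split_imp_sequence_iso_twisted[of T i p] s unfolding S_def T by blast
    define z where "z = ?bc f g"
    have z: "z \<in> Z" using c Z by (auto simp: z_def)
    \<comment> \<open>\<open>(f, g)\<close> and the components chosen for their cochain agree on the carriers: shift by \<open>\<theta> = 0\<close>\<close>
    have zero: "(\<lambda>_. \<zero>\<^bsub>V\<^esub>) \<in> linear_maps F W V" by (simp add: linear_maps_iff)
    have "cohomologous_by (\<lambda>_. \<zero>\<^bsub>V\<^esub>) (\<phi> z) (\<psi> z) f g"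
      using coc_agree[OF c] coc_closed[OF coc[OF z]]
      by (simp add: cohomologous_by_def z_def V.lact_linear(5) V.ract_linear(5) a_minus_def V.W.M.r_neg)
    from sequence_iso_shift[OF zero coc_closed[OF coc[OF z]] coc_closed[OF c] this]
    have "\<exists>h. sequence_iso F A V h (\<tau> z) s"
      using sequence_iso_trans[OF sequence_iso_trans[OF twisted_sym[OF z \<tau>_iso[OF z]]] h] by blast
    then show ?thesis using z s \<tau>_S[OF z] by (auto simp: R_def equivalent_sequences_iff)
  qed
  ultimately have "bij_betw (\<lambda>C. R `` (\<tau> ` C)) (cls ` Z) (S // R)"
    using bij_betw_fibres_quotient[of S R Z \<tau> cls] equiv_equivalent_sequences[of F A W V] \<tau>_S
    unfolding R_def S_def by blast
  then show ?thesis unfolding E1 Ext by blast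
qed

end

theorem theorem5p2:
  fixes F :: "('f, 'z) ring_scheme"
    and A :: "('f, 'a, 'x) module_scheme"
    and W :: "('f, 'a, 'w, 'y) kv_mod_scheme"
    and V :: "('f, 'a, 'v, 'u) kv_mod_scheme"
    and emb :: "'v \<times> 'w \<Rightarrow> 't"
  assumes "field F" and "char_zero F"
    and "kv_algebra F A"
    and "kv_module F A W" and "kv_module F A V"
    and universe: "inj_on emb (carrier V \<times> carrier W)"
  shows "\<exists>\<Phi> :: (('a \<times> 'w) list \<Rightarrow> 'v) set \<Rightarrow> ('f, 'a, 'v, 't, 'w) sequence set.
           bij_betw \<Phi> (E1_11 F A W V) (Ext F A W V)"
proof -
  interpret kv_module_pair F A W V
    using assms by (simp add: kv_module_pair_def)
  show ?thesis by (rule E1_11_bij_Ext[OF universe])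
qed

end
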